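(* Let $n$ and $r$ be positive integers, let $t_1,\ldots,t_r$ be positive integers and put $\sigma=\frac{t_1t_2\cdots t_r}{\max\{t_1,t_2,\ldots,t_r\}}$. Suppose $\mathcal{D}\subseteq\mathcal{D}(\mathbb{R}^n,r)$ is a (measurable) family of $r$-decompositions of $\mathbb{R}^n$ such that $\mathcal{D}_k$ is $t_k$-chain free for each $k\in\{1,\ldots,r\}$. Then $$\sum_{a_1+\cdots+a_r=n}\frac{\nu^n_{a_1,\ldots,a_r}(\mathcal{D}_{a_1,\ldots,a_r})}{\genfrac{[}{]}{0pt}{}{n}{a_1,\ldots,a_r}_{\mathbb{R}}}\le\sigma,$$ where the sum is over all $r$-tuples of positive integers $(a_1,\ldots,a_r)$ with $a_1+\cdots+a_r=n$. Consequently, $$\nu_{n;r}(\mathcal{D})\le m_1+\cdots+m_\sigma,$$ where $m_1,\ldots,m_\sigma$ are the $\sigma$ largest multiflag coefficients $\genfrac{[}{]}{0pt}{}{n}{a_1,\ldots,a_r}_{\mathbb{R}}$ for positive integers $a_1,\ldots,a_r$ with $a_1+\cdots+a_r=n$.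
   Context: $\mathrm{Mod}(n)$ is the lattice of all linear subspaces of $\mathbb{R}^n$ (with its standard inner product) ordered by inclusion. A chain of length $t$ is a collection of $t+1$ (distinct) subspaces that are pairwise comparable under inclusion; a family $\mathcal{A}\subseteq\mathrm{Mod}(n)$ is $t$-chain free if it contains no chain of length $t$. Decompositions. An $r$-decomposition of $\mathbb{R}^n$ is an $r$-tuple $(D_1,\ldots,D_r)$ of nonzero subspaces with $\bigoplus_{i=1}^rD_i=\mathbb{R}^n$ and $D_i\perp D_j$ for all $i\ne j$. $\mathcal{D}(\mathbb{R}^n,r)$ is the set of all of them, and for positive integers $a_1,\ldots,a_r$ with sum $n$, $\mathcal{D}(\mathbb{R}^n,r)_{a_1,\ldots,a_r}$ is the set of those with $\dim(D_i)=a_i$ for $i=1,\ldots,r$. For $\mathcal{D}\subseteq\mathcal{D}(\mathbb{R}^n,r)$: $\mathcal{D}_k=\{D_k\mid(D_1,\ldots,D_k,\ldots,D_r)\in\mathcal{D}\}$ and $\mathcal{D}_{a_1,\ldots,a_r}=\mathcal{D}\cap\mathcal{D}(\mathbb{R}^n,r)_{a_1,\ldots,a_r}$. Flags. $\mathrm{Flag}(n)$ is the compact manifold of complete flags $F=(F_0,\ldots,F_n)$, $F_0\subseteq F_1\subseteq\cdots\subseteq F_n$, $\dim F_k=k$, in $\mathbb{R}^n$. Let $\omega_m$ be the volume of the unit ball in $\mathbb{R}^m$ ($\omega_0=1$), $[m]_{\mathbb{R}}=\frac{m\omega_m}{2\omega_{m-1}}$ and $[m]_{\mathbb{R}}!=[m]_{\mathbb{R}}[m-1]_{\mathbb{R}}\cdots[1]_{\mathbb{R}}=\frac{m!\,\omega_m}{2^m}$.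 $\phi_n$ is the unique $O(n)$-invariant (completed Borel) measure on $\mathrm{Flag}(n)$ with total mass $[n]_{\mathbb{R}}!$. Measures. A flag $F$ is compatible with $(D_1,\ldots,D_r)\in\mathcal{D}(\mathbb{R}^n,r)_{a_1,\ldots,a_r}$ if $F_{a_1+\cdots+a_i}=D_1\oplus\cdots\oplus D_i$ for all $i\in\{1,\ldots,r\}$. For $\mathcal{E}\subseteq\mathcal{D}(\mathbb{R}^n,r)_{a_1,\ldots,a_r}$, $\mathrm{Flag}(\mathcal{E})$ is the set of all flags compatible with some member of $\mathcal{E}$; $\mathcal{E}$ is measurable if $\mathrm{Flag}(\mathcal{E})$ is $\phi_n$-measurable, and then $$\nu^n_{a_1,\ldots,a_r}(\mathcal{E})=\frac{1}{[a_1]_{\mathbb{R}}!\cdots[a_r]_{\mathbb{R}}!}\,\phi_n(\mathrm{Flag}(\mathcal{E})).$$ The total measure of $\mathcal{D}(\mathbb{R}^n,r)_{a_1,\ldots,a_r}$ is the multiflag coefficient $\genfrac{[}{]}{0pt}{}{n}{a_1,\ldots,a_r}_{\mathbb{R}}=\frac{[n]_{\mathbb{R}}!}{[a_1]_{\mathbb{R}}!\cdots[a_r]_{\mathbb{R}}!}$. A family $\mathcal{D}\subseteq\mathcal{D}(\mathbb{R}^n,r)$ is measurable if every $\mathcal{D}_{a_1,\ldots,a_r}$ is, and then $\nu_{n;r}(\mathcal{D})=\sum_{a_1+\cdots+a_r=n}\nu^n_{a_1,\ldots,a_r}(\mathcal{D}_{a_1,\ldots,a_r})$ (sum over positive integers).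 The "$\sigma$ largest" coefficients are taken from the list of values indexed by all tuples $(a_1,\ldots,a_r)$ of positive integers with sum $n$, i.e. counted with multiplicity; if $\sigma$ exceeds the number of such tuples, the missing $m_i$ are set to $0$. *)

theory Defs
  imports "HOL-Analysis.Analysis"
begin

text \<open>
  The dimension \<open>n\<close> is \<open>CARD('n)\<close>, and \<open>\<real>\<close> to the power \<open>n\<close> is \<^typ>\<open>real ^ 'n\<close>.
  An \<open>r\<close>-tuple is an extensional function on \<open>{1..r}\<close>, so that equality of tuples
  is equality of functions; likewise a flag is an extensional function on \<open>{..n}\<close>.
\<close>

definition Mod :: "(real ^ 'n) set set" where
  "Mod = {S. subspace S}"

definition chain_free :: "nat \<Rightarrow> 'a set set \<Rightarrow> bool" where
  "chain_free t A \<longleftrightarrow> \<not> (\<exists>C\<subseteq>A. finite C \<and> card C = t + 1 \<and> chain\<^sub>\<subseteq> C)"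


subsection \<open>Decompositions\<close>

definition internal_direct_sum :: "nat \<Rightarrow> (nat \<Rightarrow> (real ^ 'n) set) \<Rightarrow> bool" where
  "internal_direct_sum r D \<longleftrightarrow> (\<forall>x. \<exists>!v. v \<in> Pi\<^sub>E {1..r} D \<and> x = (\<Sum>i\<in>{1..r}. v i))"

definition decompositions :: "nat \<Rightarrow> (nat \<Rightarrow> (real ^ 'n) set) set" where
  "decompositions r =
     {D \<in> {1..r} \<rightarrow>\<^sub>E Mod.
        (\<forall>i\<in>{1..r}. D i \<noteq> {0}) \<and>
        internal_direct_sum r D \<and>
        (\<forall>i\<in>{1..r}. \<forall>j\<in>{1..r}. i \<noteq> j \<longrightarrow> (\<forall>x\<in>D i. \<forall>y\<in>D j. orthogonal x y))}"

definition compositions :: "nat \<Rightarrow> nat \<Rightarrow> (nat \<Rightarrow> nat) set" where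
  "compositions n r = {a \<in> {1..r} \<rightarrow>\<^sub>E {1..}. (\<Sum>i\<in>{1..r}. a i) = n}"

definition component :: "(nat \<Rightarrow> 'b) set \<Rightarrow> nat \<Rightarrow> 'b set" where
  "component \<D> k = {D k |D. D \<in> \<D>}"

definition of_type ::
    "nat \<Rightarrow> (nat \<Rightarrow> nat) \<Rightarrow> (nat \<Rightarrow> (real ^ 'n) set) set \<Rightarrow> (nat \<Rightarrow> (real ^ 'n) set) set" where
  "of_type r a \<D> = \<D> \<inter> {D \<in> decompositions r. \<forall>i\<in>{1..r}. dim (D i) = a i}"


subsection \<open>Flag coefficients\<close>

definition real_bracket :: "nat \<Rightarrow> real" where
  "real_bracket m = real m * unit_ball_vol (real m) / (2 * unit_ball_vol (real m - 1))"

definition real_bracket_fact :: "nat \<Rightarrow> real" where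
  "real_bracket_fact m = (\<Prod>k\<in>{1..m}. real_bracket k)"

definition multiflag_coeff :: "nat \<Rightarrow> nat \<Rightarrow> (nat \<Rightarrow> nat) \<Rightarrow> real" where
  "multiflag_coeff n r a = real_bracket_fact n / (\<Prod>i\<in>{1..r}. real_bracket_fact (a i))"


subsection \<open>The invariant measure on complete flags\<close>

definition flags :: "(nat \<Rightarrow> (real ^ 'n) set) set" where
  "flags =
     {F \<in> {..CARD('n)} \<rightarrow>\<^sub>E Mod.
        (\<forall>k\<le>CARD('n). dim (F k) = k) \<and> (\<forall>k<CARD('n). F k \<subseteq> F (Suc k))}"

text \<open>
  The manifold topology on flags: a flag is identified with the family of orthogonal
  projections onto its members (for a subspace, \<^const>\<open>closest_point\<close> is orthogonal projection).
  The function space carries the product topology, that is, pointwise convergence, which for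
  linear maps in finite dimension is norm convergence. Indices \<open>k\<close> above \<open>n\<close> contribute only
  constant coordinates.
\<close>

definition flag_topology :: "(nat \<Rightarrow> (real ^ 'n) set) topology" where
  "flag_topology =
     pullback_topology flags
       (\<lambda>F. (\<lambda>k x. closest_point (F k) x) :: nat \<Rightarrow> real ^ 'n \<Rightarrow> real ^ 'n) euclidean"

definition flag_act ::
    "(real ^ 'n \<Rightarrow> real ^ 'n) \<Rightarrow> (nat \<Rightarrow> (real ^ 'n) set) \<Rightarrow> (nat \<Rightarrow> (real ^ 'n) set)" where
  "flag_act g F = (\<lambda>k\<in>{..CARD('n)}. g ` F k)"

definition invariant_flag_measure :: "(nat \<Rightarrow> (real ^ 'n) set) measure \<Rightarrow> bool" where
  "invariant_flag_measure M \<longleftrightarrow>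
     space M = flags \<and>
     sets M = sigma_sets flags {U. openin flag_topology U} \<and>
     emeasure M flags = ennreal (real_bracket_fact CARD('n)) \<and>
     (\<forall>g A. orthogonal_transformation g \<longrightarrow> A \<in> sets M \<longrightarrow>
        emeasure M (flag_act g ` A) = emeasure M A)"

text \<open>
  The description is proper: there is exactly one \<^const>\<open>invariant_flag_measure\<close>, because flags
  form a compact homogeneous space of the orthogonal group.
\<close>

definition flag_measure :: "(nat \<Rightarrow> (real ^ 'n) set) measure" where
  "flag_measure = completion (THE M. invariant_flag_measure M)"


subsection \<open>Measures of families of decompositions\<close>

text \<open>The sum of subspaces below is the elementwise sum of sets.\<close>

definition compatible ::
    "nat \<Rightarrow> (nat \<Rightarrow> nat) \<Rightarrow> (nat \<Rightarrow> (real ^ 'n) set) \<Rightarrow> (nat \<Rightarrow> (real ^ 'n) set) \<Rightarrow> bool" where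
  "compatible r a F D \<longleftrightarrow> (\<forall>i\<in>{1..r}. F (\<Sum>j\<in>{1..i}. a j) = (\<Sum>j\<in>{1..i}. D j))"

definition Flag ::
    "nat \<Rightarrow> (nat \<Rightarrow> nat) \<Rightarrow> (nat \<Rightarrow> (real ^ 'n) set) set \<Rightarrow> (nat \<Rightarrow> (real ^ 'n) set) set" where
  "Flag r a \<E> = {F \<in> flags. \<exists>D\<in>\<E>. compatible r a F D}"

definition nu :: "nat \<Rightarrow> (nat \<Rightarrow> nat) \<Rightarrow> (nat \<Rightarrow> (real ^ 'n) set) set \<Rightarrow> real" where
  "nu r a \<E> =
     1 / (\<Prod>i\<in>{1..r}. real_bracket_fact (a i)) * measure flag_measure (Flag r a \<E>)"

definition measurable_family :: "nat \<Rightarrow> (nat \<Rightarrow> (real ^ 'n) set) set \<Rightarrow> bool" where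
  "measurable_family r \<D> \<longleftrightarrow>
     (\<forall>a\<in>compositions CARD('n) r. Flag r a (of_type r a \<D>) \<in> sets flag_measure)"

definition nu_total :: "nat \<Rightarrow> (nat \<Rightarrow> (real ^ 'n) set) set \<Rightarrow> real" where
  "nu_total r \<D> = (\<Sum>a\<in>compositions CARD('n) r. nu r a (of_type r a \<D>))"


text \<open>
  Sum of the \<open>s\<close> largest elements, counted with multiplicity; elements missing when the
  multiset has fewer than \<open>s\<close> of them count as \<open>0\<close>.
\<close>

definition sum_largest :: "nat \<Rightarrow> real multiset \<Rightarrow> real" where
  "sum_largest s M = sum_list (take s (rev (sorted_list_of_multiset M)))"

definition multiflag_coeffs :: "nat \<Rightarrow> nat \<Rightarrow> real multiset" where
  "multiflag_coeffs n r = image_mset (multiflag_coeff n r) (mset_set (compositions n r))"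

end

theory Submission
  imports Defs "HOL-Probability.Infinite_Product_Measure"
begin

text \<open>
  Let \<open>g\<close> be a Haar-random orthogonal matrix. By uniqueness of the invariant measure, \<open>g F\<close> is a
  uniformly random flag for every fixed flag \<open>F\<close>. Hence for each ordered partition \<open>P\<close> of the
  coordinates into blocks of sizes \<open>a\<^sub>1, \<dots>, a\<^sub>r\<close>, the normalised measure of \<open>\<D>\<^sub>a\<close> is the probability that \<open>g\<close> maps
  the decomposition into the coordinate subspaces of \<open>P\<close> to a member of \<open>\<D>\<close>. Averaging over all
  \<open>P\<close> of type \<open>a\<close> and summing over \<open>a\<close> reduces the bound, for each fixed \<open>g\<close>, to the Meshalkin-type
  inequality of Beck and Zaslavsky for families of ordered set partitions, which follows from the
  chain-free LYM inequality by splitting off one block at a time.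
\<close>

section \<open>Ordered set partitions\<close>

text \<open>\<open>flag_measure\<close> is given by a definite description, so it is only accessible
  once some invariant measure is exhibited and shown to be the only one. Haar measure serves both
  ends: its image under an orbit map is invariant, and averaging over it determines every invariant
  measure.

  Measurability of \<D> refers to the completed measure, so the event that \<open>g\<close> carries
  a coordinate decomposition into \<D> need not be measurable. Each set of flags is therefore
  replaced by a Borel subset of the same measure; the bound for fixed \<open>g\<close> only uses
  that this subset lies inside.

  Orthogonality makes flags a faithful substitute for decompositions: a flag and a type are
  compatible with at most one orthogonal decomposition.

  All blocks but one of a set partition determine the last, so a factor \<open>t k\<close> is paid
  for all blocks but one; the block spared is one with the largest \<open>t k\<close>, whence the
  division by the maximum.

  For the second inequality, the normalised measures are weights in [0,1] with sum at most \<sigma>,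
  and such weights are best spent on the \<sigma> largest coefficients.\<close>

lemma chain_free_mono: "chain_free t A \<Longrightarrow> B \<subseteq> A \<Longrightarrow> chain_free t B"
  unfolding chain_free_def by blast

text \<open>
  For a proper subset \<open>A\<close> of \<open>S\<close>, the weight \<open>1 / (card S choose card A)\<close> is the sum of the weights of \<open>A\<close>
  in the sets \<open>S - {x}\<close> containing it, divided by \<open>card S\<close>; so one can induct on \<open>S\<close>, and a member
  equal to \<open>S\<close> itself tops every chain.
\<close>

lemma lubell_chain_free:
  assumes "finite S" "chain_free t F"
  shows "(\<Sum>A\<in>F \<inter> Pow S. 1 / real (card S choose card A)) \<le> real t"
  using assms
proof (induction "card S" arbitrary: S F t)
  case 0
  then have S: "S = {}" by simp
  show ?case
  proof (cases "{} \<in> F")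
    case True
    have "t \<noteq> 0"
    proof
      assume "t = 0"
      moreover have "{{}} \<subseteq> F" "finite {{}::'a set}" "card {{}::'a set} = 1" "chain\<^sub>\<subseteq> {{}::'a set}"
        using True by (auto simp: chain_subset_def)
      ultimately show False using 0(3) unfolding chain_free_def by (metis add.left_neutral)
    qed
    moreover have "F \<inter> Pow S = {{}}" using True S by auto
    ultimately show ?thesis by (simp add: S)
  next
    case False
    then have "F \<inter> Pow S = {}" using S by auto
    then show ?thesis by simp
  qed
next
  case (Suc n)
  have proper: "(\<Sum>A\<in>G \<inter> Pow S. 1 / real (card S choose card A)) \<le> real u"
    if "S \<notin> G" and cf: "chain_free u G" for G u
  proof -
    have *: "1 / real (Suc n choose card A)
        = (\<Sum>x\<in>S - A. 1 / real (n choose card A)) / Suc n" if "A \<in> G \<inter> Pow S" for A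
    proof -
      have "A \<subset> S" using that \<open>S \<notin> G\<close> by auto
      then have le: "card A < card S" using Suc(3) psubset_card_mono by blast
      have c: "card (S - A) = Suc n - card A"
        using \<open>A \<subset> S\<close> Suc(2,3) finite_subset[of A S]
        by (subst card_Diff_subset) (auto simp del: card_Diff_subset)
      have "Suc n * (n choose card A) = (Suc n choose card A) * (Suc n - card A)"
        using binomial_absorb_comp[of "Suc n" "card A"] by (simp add: mult.commute)
      then have "real (Suc n) * real (n choose card A)
          = real (Suc n choose card A) * real (Suc n - card A)"
        by (metis of_nat_mult)
      moreover have "0 < n choose card A" "0 < Suc n choose card A"
        using le Suc(2) by auto
      ultimately show ?thesis
        using c by (simp add: field_simps del: of_nat_Suc binomial_Suc_Suc)
    qed
    have "(\<Sum>A\<in>G \<inter> Pow S. 1 / real (card S choose card A))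
        = (\<Sum>A\<in>G \<inter> Pow S. (\<Sum>x\<in>S - A. 1 / real (n choose card A)) / Suc n)"
      unfolding Suc(2)[symmetric] by (rule sum.cong[OF refl *])
    also have "\<dots> = (\<Sum>A\<in>G \<inter> Pow S. \<Sum>x\<in>S - A. 1 / real (n choose card A)) / Suc n"
      by (rule sum_divide_distrib[symmetric])
    also have "(\<Sum>A\<in>G \<inter> Pow S. \<Sum>x\<in>S - A. 1 / real (n choose card A))
        = (\<Sum>x\<in>S. \<Sum>A\<in>G \<inter> Pow (S - {x}). 1 / real (n choose card A))"
    proof -
      have fin: "finite (G \<inter> Pow S)" using Suc(3) by simp
      have 1: "S - A = {x \<in> S. x \<notin> A}" for A by blast
      have 2: "G \<inter> Pow (S - {x}) = {A \<in> G \<inter> Pow S. x \<notin> A}" for x by blast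
      show ?thesis
        unfolding 2 unfolding 1 by (rule sum.swap_restrict[OF fin Suc(3)])
    qed
    also have "\<dots> \<le> (\<Sum>x\<in>S. real u)"
    proof (rule sum_mono)
      fix x assume x: "x \<in> S"
      have "card (S - {x}) = n" using x Suc(2,3) by simp
      with Suc(1)[of "S - {x}" u G] Suc(3) cf
      show "(\<Sum>A\<in>G \<inter> Pow (S - {x}). 1 / real (n choose card A)) \<le> real u" by simp
    qed
    also have "\<dots> = real (Suc n) * u" using Suc(2) by simp
    finally show ?thesis by (simp add: divide_right_mono field_simps del: of_nat_Suc)
  qed
  show ?case
  proof (cases "S \<in> F")
    case False
    then show ?thesis using proper Suc(4) by blast
  next
    case True
    have pos: "t \<noteq> 0"
    proof
      assume "t = 0"
      moreover have "{S} \<subseteq> F" "finite {S}" "card {S} = 1" "chain\<^sub>\<subseteq> {S}"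
        using True by (auto simp: chain_subset_def)
      ultimately show False using Suc(4) unfolding chain_free_def by (metis add.left_neutral)
    qed
    let ?G = "F \<inter> Pow S - {S}"
    have "chain_free (t - 1) ?G"
      unfolding chain_free_def
    proof
      assume "\<exists>C\<subseteq>?G. finite C \<and> card C = t - 1 + 1 \<and> chain\<^sub>\<subseteq> C"
      then obtain C where C: "C \<subseteq> ?G" "finite C" "card C = t - 1 + 1" "chain\<^sub>\<subseteq> C" by blast
      then have "S \<notin> C" by auto
      then have "insert S C \<subseteq> F" "finite (insert S C)" "card (insert S C) = t + 1"
        "chain\<^sub>\<subseteq> (insert S C)"
        using C True pos by (auto simp: chain_subset_def)
      then show False using Suc(4) unfolding chain_free_def by blast
    qed
    then have "(\<Sum>A\<in>?G \<inter> Pow S. 1 / real (card S choose card A)) \<le> real (t - 1)"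
      using proper by blast
    moreover have "?G \<inter> Pow S = ?G" by auto
    moreover have "(\<Sum>A\<in>F \<inter> Pow S. 1 / real (card S choose card A))
        = 1 + (\<Sum>A\<in>?G. 1 / real (card S choose card A))"
      using True Suc(3) by (subst sum.remove[of _ S]) auto
    ultimately show ?thesis using pos by simp
  qed
qed

text \<open>Blocks may be empty, so that splitting off a block needs no case distinction; positivity
  of the sizes enters later through \<open>compositions\<close>.\<close>

definition ordered_partitions :: "'i set \<Rightarrow> 'a set \<Rightarrow> ('i \<Rightarrow> 'a set) set" where
  "ordered_partitions I S =
     {P \<in> I \<rightarrow>\<^sub>E Pow S. disjoint_family_on P I \<and> (\<Union>i\<in>I. P i) = S}"

text \<open>For an ordered partition \<open>P\<close>, this is its probability under the uniform
  distribution on all ordered partitions of \<open>S\<close> with the same block sizes.\<close>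

definition inverse_multinomial :: "'i set \<Rightarrow> ('i \<Rightarrow> 'a set) \<Rightarrow> 'a set \<Rightarrow> real" where
  "inverse_multinomial I P S = (\<Prod>i\<in>I. fact (card (P i))) / fact (card S)"

lemma finite_ordered_partitions:
  "finite I \<Longrightarrow> finite S \<Longrightarrow> finite (ordered_partitions I S)"
  unfolding ordered_partitions_def
  by (rule finite_subset[of _ "I \<rightarrow>\<^sub>E Pow S"]) (auto intro: finite_PiE)

text \<open>Drives the inductions on the number of blocks: conditioning on block \<open>i\<close>
  leaves the same kind of object on a smaller ground set.\<close>

lemma ordered_partitions_fibre:
  assumes "i \<notin> I" "A \<subseteq> S"
  shows "bij_betw (\<lambda>P. restrict P I) {P \<in> ordered_partitions (insert i I) S. P i = A}
           (ordered_partitions I (S - A))"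
proof (rule bij_betw_byWitness[where f' = "\<lambda>Q. Q(i := A)"])
  show "\<forall>P\<in>{P \<in> ordered_partitions (insert i I) S. P i = A}. (restrict P I)(i := A) = P"
    by (auto simp: ordered_partitions_def fun_eq_iff PiE_def extensional_def)
  show "\<forall>Q\<in>ordered_partitions I (S - A). restrict (Q(i := A)) I = Q"
    using assms by (auto simp: ordered_partitions_def fun_eq_iff PiE_def extensional_def)
  show "(\<lambda>P. restrict P I) ` {P \<in> ordered_partitions (insert i I) S. P i = A}
      \<subseteq> ordered_partitions I (S - A)"
  proof clarify
    fix P assume P: "P \<in> ordered_partitions (insert i I) S"
    have d: "P i \<inter> P j = {}" if "j \<in> I" for j
      using P that assms by (auto simp: ordered_partitions_def disjoint_family_on_def)
    have u: "P i \<union> (\<Union>j\<in>I. P j) = S" using P by (auto simp: ordered_partitions_def)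
    have "disjoint_family_on (restrict P I) I"
      using P by (auto simp: ordered_partitions_def disjoint_family_on_def)
    then show "restrict P I \<in> ordered_partitions I (S - P i)"
      using d u by (auto simp: ordered_partitions_def)
  qed
  show "(\<lambda>Q. Q(i := A)) ` ordered_partitions I (S - A)
      \<subseteq> {P \<in> ordered_partitions (insert i I) S. P i = A}"
  proof clarify
    fix Q assume Q: "Q \<in> ordered_partitions I (S - A)"
    have sub: "Q j \<subseteq> S - A" if "j \<in> I" for j using Q that by (auto simp: ordered_partitions_def)
    have "disjoint_family_on (Q(i := A)) (insert i I)"
      using Q sub assms unfolding ordered_partitions_def disjoint_family_on_def
      by (auto; blast)
    moreover have "(\<Union>j\<in>I. Q j) = S - A" using Q by (auto simp: ordered_partitions_def)
    then have "(\<Union>j\<in>insert i I. (Q(i := A)) j) = S"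
    proof -
      have "I \<inter> {j. j \<noteq> i} = I" using assms by auto
      then show ?thesis using \<open>(\<Union>j\<in>I. Q j) = S - A\<close> assms by auto
    qed
    moreover have "Q(i := A) \<in> insert i I \<rightarrow>\<^sub>E Pow S"
      using Q assms by (auto simp: ordered_partitions_def PiE_def extensional_def)
    ultimately show "Q(i := A) \<in> ordered_partitions (insert i I) S \<and> (Q(i := A)) i = A"
      unfolding ordered_partitions_def mem_Collect_eq by (intro conjI fun_upd_same)
  qed
qed

text \<open>The chain rule of probability: draw block \<open>i\<close> first, then the others from
  what remains.\<close>

lemma inverse_multinomial_insert:
  assumes "finite I" "i \<notin> I" "finite S" "P i \<subseteq> S"
  shows "inverse_multinomial (insert i I) P S
    = 1 / real (card S choose card (P i)) * inverse_multinomial I (restrict P I) (S - P i)"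
proof -
  have "card (P i) \<le> card S" "card (S - P i) = card S - card (P i)"
    using assms by (auto simp: card_mono card_Diff_subset finite_subset)
  then show ?thesis
    using assms by (simp add: inverse_multinomial_def binomial_fact)
qed

text \<open>Normalisation, which later allows averaging over all partitions of one type. Each of the
  \<open>card S choose a i\<close> choices of block \<open>i\<close> contributes its reciprocal, the
  conditional weights summing to 1 by induction.\<close>

lemma sum_inverse_multinomial_type:
  assumes "finite I" "finite S" "(\<Sum>i\<in>I. a i) = card S"
  shows "(\<Sum>P\<in>{P \<in> ordered_partitions I S. \<forall>i\<in>I. card (P i) = a i}.
            inverse_multinomial I P S) = 1"
  using assms
proof (induction I arbitrary: S rule: finite_induct)
  case empty
  then have "S = {}" by simp
  then have "{P \<in> ordered_partitions {} S. \<forall>i\<in>{}. card (P i) = a i} = {\<lambda>_. undefined}"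
    by (auto simp: ordered_partitions_def disjoint_family_on_def)
  then show ?case by (simp add: inverse_multinomial_def \<open>S = {}\<close>)
next
  case (insert i I)
  let ?T = "\<lambda>I S. {P \<in> ordered_partitions I S. \<forall>j\<in>I. card (P j) = a j}"
  let ?C = "{A. A \<subseteq> S \<and> card A = a i}"
  have fin: "finite ?C" "finite (?T (insert i I) S)"
    using insert finite_ordered_partitions[of "insert i I" S] by auto
  have le: "a i \<le> card S" using insert by simp
  have "(\<Sum>P\<in>?T (insert i I) S. inverse_multinomial (insert i I) P S)
      = (\<Sum>A\<in>?C. \<Sum>P\<in>{P \<in> ?T (insert i I) S. P i = A}. inverse_multinomial (insert i I) P S)"
    by (rule sum.group[symmetric]) (use fin in \<open>auto simp: ordered_partitions_def\<close>)
  also have "\<dots> = (\<Sum>A\<in>?C. 1 / real (card S choose a i))"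
  proof (rule sum.cong[OF refl])
    fix A assume A: "A \<in> ?C"
    have finA: "finite A" using A insert by (auto intro: finite_subset)
    have bij: "bij_betw (\<lambda>P. restrict P I) {P \<in> ?T (insert i I) S. P i = A} (?T I (S - A))"
    proof -
      have b: "bij_betw (\<lambda>P. restrict P I) {P \<in> ordered_partitions (insert i I) S. P i = A}
           (ordered_partitions I (S - A))"
        using A insert(2) by (intro ordered_partitions_fibre) auto
      have e: "{P \<in> ?T (insert i I) S. P i = A}
          = {P \<in> {P \<in> ordered_partitions (insert i I) S. P i = A}. \<forall>j\<in>I. card (restrict P I j) = a j}"
        using A by auto
      show ?thesis
        unfolding e
      proof (rule bij_betw_subset[OF b])
        show "(\<lambda>P. restrict P I) ` {P \<in> {P \<in> ordered_partitions (insert i I) S. P i = A}.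
            \<forall>j\<in>I. card (restrict P I j) = a j} = ?T I (S - A)"
          unfolding bij_betw_imp_surj_on[OF b, symmetric] by blast
      qed blast
    qed
    have "(\<Sum>P\<in>{P \<in> ?T (insert i I) S. P i = A}. inverse_multinomial (insert i I) P S)
        = (\<Sum>P\<in>{P \<in> ?T (insert i I) S. P i = A}.
             1 / real (card S choose a i) * inverse_multinomial I (restrict P I) (S - A))"
      using A insert inverse_multinomial_insert[of I i S] by (intro sum.cong) auto
    also have "\<dots> = 1 / real (card S choose a i) * (\<Sum>Q\<in>?T I (S - A). inverse_multinomial I Q (S - A))"
      unfolding sum_distrib_left[symmetric] by (subst sum.reindex_bij_betw[OF bij]) simp
    also have "(\<Sum>Q\<in>?T I (S - A). inverse_multinomial I Q (S - A)) = 1"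
      using insert A finA by (intro insert) (auto simp: card_Diff_subset)
    finally show "(\<Sum>P\<in>{P \<in> ?T (insert i I) S. P i = A}. inverse_multinomial (insert i I) P S)
        = 1 / real (card S choose a i)" by simp
  qed
  also have "\<dots> = 1" using le insert n_subsets[of S "a i"] by simp
  finally show ?case .
qed

text \<open>Group the family by its block \<open>i\<close>. Within a group the remaining blocks form
  a family on \<open>S - A\<close> that inherits the chain conditions, so by induction it weighs at
  most the product over \<open>J\<close>; the sets \<open>A\<close> that occur are chain free, so
  their LYM weights sum to at most \<open>t i\<close>. Block \<open>m\<close> is the complement of
  the others and costs no factor.\<close>

lemma meshalkin_chain_free:
  assumes "finite J" "m \<notin> J" "finite S" "\<M> \<subseteq> ordered_partitions (insert m J) S"
    and "\<And>i. i \<in> J \<Longrightarrow> chain_free (t i) ((\<lambda>P. P i) ` \<M>)"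
  shows "(\<Sum>P\<in>\<M>. inverse_multinomial (insert m J) P S) \<le> (\<Prod>i\<in>J. real (t i))"
  using assms
proof (induction J arbitrary: S \<M> rule: finite_induct)
  case empty
  \<comment> \<open>With only block \<open>m\<close> left the partition is forced and has weight 1,
    the empty product.\<close>
  have "ordered_partitions {m} S \<subseteq> {\<lambda>j\<in>{m}. S}"
    by (auto simp: ordered_partitions_def PiE_def extensional_def fun_eq_iff)
  then have "\<M> \<subseteq> {\<lambda>j\<in>{m}. S}" using empty by blast
  then have "\<M> = {} \<or> \<M> = {\<lambda>j\<in>{m}. S}" by auto
  then show ?case by (auto simp: inverse_multinomial_def)
next
  case (insert i J)
  let ?I = "insert m J"
  have I: "insert m (insert i J) = insert i ?I" "i \<notin> ?I" "finite ?I" using insert by auto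
  have fin: "finite \<M>"
    using finite_ordered_partitions[of "insert m (insert i J)" S] insert(1,5,6)
    by (auto intro: finite_subset)
  have sub: "(\<lambda>P. P i) ` \<M> \<subseteq> Pow S" using insert(6) by (auto simp: ordered_partitions_def)
  have "(\<Sum>P\<in>\<M>. inverse_multinomial (insert i ?I) P S)
      = (\<Sum>A\<in>(\<lambda>P. P i) ` \<M>. \<Sum>P\<in>{P \<in> \<M>. P i = A}. inverse_multinomial (insert i ?I) P S)"
    by (rule sum.image_gen[OF fin])
  also have "\<dots> \<le> (\<Sum>A\<in>(\<lambda>P. P i) ` \<M>. 1 / real (card S choose card A) * (\<Prod>j\<in>J. real (t j)))"
  proof (rule sum_mono)
    fix A assume "A \<in> (\<lambda>P. P i) ` \<M>"
    then have A: "A \<subseteq> S" using sub by auto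
    let ?N = "(\<lambda>P. restrict P ?I) ` {P \<in> \<M>. P i = A}"
    note b = ordered_partitions_fibre[OF I(2) A]
    have sub2: "{P \<in> \<M>. P i = A} \<subseteq> {P \<in> ordered_partitions (insert i ?I) S. P i = A}"
      using insert(6) I by auto
    have inj: "inj_on (\<lambda>P. restrict P ?I) {P \<in> \<M>. P i = A}"
      using b sub2 by (meson bij_betw_def inj_on_subset)
    have "(\<Sum>P\<in>{P \<in> \<M>. P i = A}. inverse_multinomial (insert i ?I) P S)
        = (\<Sum>P\<in>{P \<in> \<M>. P i = A}. 1 / real (card S choose card A)
            * inverse_multinomial ?I (restrict P ?I) (S - A))"
      using A insert(5) I inverse_multinomial_insert[of ?I i S] by (intro sum.cong) auto
    also have "\<dots> = 1 / real (card S choose card A) * (\<Sum>Q\<in>?N. inverse_multinomial ?I Q (S - A))"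
      unfolding sum_distrib_left[symmetric] by (subst sum.reindex[OF inj]) simp
    also have "\<dots> \<le> 1 / real (card S choose card A) * (\<Prod>j\<in>J. real (t j))"
    proof (intro mult_left_mono insert(3))
      show "?N \<subseteq> ordered_partitions ?I (S - A)"
        using image_mono[OF sub2] unfolding bij_betw_imp_surj_on[OF b, symmetric] .
      fix j assume j: "j \<in> J"
      then have "(\<lambda>P. P j) ` ?N \<subseteq> (\<lambda>P. P j) ` \<M>" by auto
      then show "chain_free (t j) ((\<lambda>P. P j) ` ?N)"
        using insert(7)[of j] j chain_free_mono by blast
    qed (use insert in auto)
    finally show "(\<Sum>P\<in>{P \<in> \<M>. P i = A}. inverse_multinomial (insert i ?I) P S)
       \<le> 1 / real (card S choose card A) * (\<Prod>j\<in>J. real (t j))" .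
  qed
  also have "\<dots> = (\<Sum>A\<in>(\<lambda>P. P i) ` \<M>. 1 / real (card S choose card A)) * (\<Prod>j\<in>J. real (t j))"
    by (simp add: sum_distrib_right)
  also have "\<dots> \<le> real (t i) * (\<Prod>j\<in>J. real (t j))"
  proof (rule mult_right_mono)
    show "(\<Sum>A\<in>(\<lambda>P. P i) ` \<M>. 1 / real (card S choose card A)) \<le> real (t i)"
      using lubell_chain_free[OF insert(5) insert(7)[of i]] unfolding Int_absorb2[OF sub] by simp
  qed (simp add: prod_nonneg)
  finally show ?case using insert by (simp add: insert_commute)
qed

section \<open>Weighted sums and the largest values\<close>

text \<open>The fractional knapsack argument: moving weight from indices with small values to
  indices with large ones, up to the cap 1, never decreases the sum.\<close>

lemma sum_le_sum_largest:
  assumes "finite A" and x: "\<And>a. a \<in> A \<Longrightarrow> 0 \<le> x a \<and> x a \<le> 1"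
    and f: "\<And>a. a \<in> A \<Longrightarrow> 0 \<le> f a" and s: "(\<Sum>a\<in>A. x a) \<le> real s"
  shows "(\<Sum>a\<in>A. x a * f a) \<le> sum_largest s (image_mset f (mset_set A))"
proof -
  obtain bs where bs: "set bs = A" "distinct bs" using finite_distinct_list[OF \<open>finite A\<close>] by blast
  \<comment> \<open>Sorting the indices rather than the values records which indices carry the
    largest values, even when values repeat.\<close>
  define as where "as = rev (sort_key f bs)"
  have as: "set as = A" "distinct as" by (auto simp: as_def bs)
  have so: "sorted (map f (rev as))" by (simp add: as_def)
  have "mset (map f (rev as)) = image_mset f (mset_set A)"
    using as by (metis mset_map mset_rev mset_set_set)
  then have "sorted_list_of_multiset (image_mset f (mset_set A)) = map f (rev as)"
    using so by (metis sorted_list_of_multiset_mset sorted_sort_id)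
  then have L: "sum_largest s (image_mset f (mset_set A)) = sum_list (map f (take s as))"
    by (simp add: sum_largest_def rev_map take_map)
  let ?T = "set (take s as)"
  have T: "?T \<subseteq> A" "finite ?T" using as set_take_subset by fastforce+
  have L': "sum_list (map f (take s as)) = (\<Sum>a\<in>?T. f a)"
    using as by (simp add: sum_list_distinct_conv_sum_set)
  show ?thesis
  proof (cases "length as \<le> s")
    case True
    then have "?T = A" using as by simp
    then show ?thesis unfolding L L' using x f by (auto intro!: sum_mono mult_left_le_one_le)
  next
    case False
    \<comment> \<open>Positions start at 0, so this is the value of the first index left out of
      \<open>take s as\<close>; it separates the chosen values from the others.\<close>
    define \<tau> where "\<tau> = f (as ! s)"
    have asA: "as ! s \<in> A" using False as by (metis not_le nth_mem)
    have dec: "f (as ! j) \<le> f (as ! i)" if "i \<le> j" "j < length as" for i j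
    proof -
      have "f (rev as ! (length as - Suc j)) \<le> f (rev as ! (length as - Suc i))"
        using sorted_nth_mono[OF so, of "length as - Suc j" "length as - Suc i"] that by simp
      then show ?thesis using that by (simp add: rev_nth)
    qed
    have hi: "\<tau> \<le> f a" if "a \<in> ?T" for a
    proof -
      obtain i where "i < s" "a = as ! i"
        using \<open>a \<in> ?T\<close> False unfolding in_set_conv_nth by auto
      then show ?thesis using dec[of i s] False by (simp add: \<tau>_def)
    qed
    have lo: "f a \<le> \<tau>" if "a \<in> A - ?T" for a
    proof -
      have "a \<in> set as" using that as(1) by blast
      then obtain i where i: "i < length as" "a = as ! i" unfolding in_set_conv_nth by blast
      have "\<not> i < s"
      proof
        assume "i < s"
        then have "take s as ! i \<in> ?T" using False by (intro nth_mem) simp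
        then show False using that i \<open>i < s\<close> by simp
      qed
      then show ?thesis using dec[of s i] i by (simp add: \<tau>_def)
    qed
    have card: "real (card ?T) = real s" using False as by (simp add: distinct_card)
    have tau0: "0 \<le> \<tau>" using f asA by (simp add: \<tau>_def)
    have split: "(\<Sum>a\<in>A. g a) = (\<Sum>a\<in>?T. g a) + (\<Sum>a\<in>A - ?T. g a)" for g :: "_ \<Rightarrow> real"
      using sum.subset_diff[OF T(1) \<open>finite A\<close>, of g] by simp
    \<comment> \<open>The exchange: weight outside \<open>?T\<close> is worth at most \<tau> per
      unit, and there is no more of it than the weight \<open>1 - x a\<close> missing inside
      \<open>?T\<close>, where each unit is worth at least \<tau>.\<close>
    have "(\<Sum>a\<in>A - ?T. x a * f a) \<le> (\<Sum>a\<in>A - ?T. x a * \<tau>)"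
      using lo x by (intro sum_mono mult_left_mono) auto
    also have "\<dots> = \<tau> * ((\<Sum>a\<in>A. x a) - (\<Sum>a\<in>?T. x a))"
      using split[of x] by (simp add: sum_distrib_left mult.commute)
    also have "\<dots> \<le> \<tau> * (real s - (\<Sum>a\<in>?T. x a))"
      using s tau0 by (intro mult_left_mono) auto
    also have "\<dots> = (\<Sum>a\<in>?T. (1 - x a) * \<tau>)"
      using card by (simp add: sum_distrib_right[symmetric] sum_subtractf)
    also have "\<dots> \<le> (\<Sum>a\<in>?T. (1 - x a) * f a)"
      using hi x T by (intro sum_mono mult_left_mono) auto
    also have "\<dots> = (\<Sum>a\<in>?T. f a) - (\<Sum>a\<in>?T. x a * f a)"
      by (simp add: sum_subtractf left_diff_distrib)
    finally show ?thesis unfolding L L' split[of "\<lambda>a. x a * f a"] by simp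
  qed
qed

section \<open>Haar measure on the orthogonal group\<close>

text \<open>Since \<open>sgn 0 = 0\<close>, a vector depending on its predecessors yields 0. Every
  output is thus zero or a unit vector, and orthogonality holds for arbitrary input.\<close>

fun gram_schmidt :: "(nat \<Rightarrow> 'a::real_inner) \<Rightarrow> nat \<Rightarrow> 'a" where
  "gram_schmidt x k =
     sgn (x k - (\<Sum>j<k. (gram_schmidt x j \<bullet> x k) *\<^sub>R gram_schmidt x j))"

declare gram_schmidt.simps [simp del]

lemma norm_gram_schmidt: "gram_schmidt x k \<noteq> 0 \<Longrightarrow> norm (gram_schmidt x k) = 1"
  unfolding gram_schmidt.simps[of x k] by (simp add: norm_sgn sgn_zero_iff)

lemma gram_schmidt_orthogonal_less: "i < k \<Longrightarrow> gram_schmidt x i \<bullet> gram_schmidt x k = 0"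
proof (induction k arbitrary: i rule: less_induct)
  case (less k)
  let ?g = "gram_schmidt x"
  have o: "?g i \<bullet> ?g j = 0" if "j < k" "j \<noteq> i" for j
    using less that by (metis inner_commute linorder_neqE_nat)
  have "?g i \<bullet> (\<Sum>j<k. (?g j \<bullet> x k) *\<^sub>R ?g j) = (\<Sum>j<k. (?g j \<bullet> x k) * (?g i \<bullet> ?g j))"
    by (simp add: inner_sum_right)
  also have "\<dots> = (\<Sum>j\<in>{i}. (?g j \<bullet> x k) * (?g i \<bullet> ?g j))"
    using less(2) o by (intro sum.mono_neutral_right) auto
  also have "\<dots> = ?g i \<bullet> x k"
    using norm_gram_schmidt[of x i] by (cases "?g i = 0") (auto simp: norm_eq_1)
  finally show ?case
    unfolding gram_schmidt.simps[of x k] by (simp add: sgn_div_norm inner_diff_right)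
qed

lemma gram_schmidt_orthogonal: "i \<noteq> k \<Longrightarrow> gram_schmidt x i \<bullet> gram_schmidt x k = 0"
  by (metis gram_schmidt_orthogonal_less inner_commute linorder_neqE_nat)

text \<open>The recursion uses only linear operations, norms and inner products. This equivariance
  is what turns rotation-invariant random vectors into a left-invariant random matrix.\<close>

lemma gram_schmidt_orthogonal_transformation:
  assumes "orthogonal_transformation h"
  shows "gram_schmidt (\<lambda>i. h (x i)) k = h (gram_schmidt x k)"
proof (induction k rule: less_induct)
  case (less k)
  have lin: "linear h" using assms by (rule orthogonal_transformation_linear)
  have s: "sgn (h v) = h (sgn v)" for v
    using assms lin by (simp add: sgn_div_norm linear_cmul orthogonal_transformation_norm)
  show ?case
    unfolding gram_schmidt.simps[of _ k] s[symmetric] linear_diff[OF lin] linear_sum[OF lin] linear_cmul[OF lin]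
    using less assms by (simp add: orthogonal_transformation_def cong: sum.cong_simp)
qed

text \<open>Used to detect degeneracy: if some output is 0, the inputs lie in the span of fewer than
  \<open>n\<close> vectors.\<close>

lemma in_span_gram_schmidt:
  assumes "k < n"
  shows "x k \<in> span (gram_schmidt x ` {..<n} - {0})"
proof -
  let ?g = "gram_schmidt x" and ?s = "\<Sum>j<k. (gram_schmidt x j \<bullet> x k) *\<^sub>R gram_schmidt x j"
  have g: "?g j \<in> span (?g ` {..<n} - {0})" if "j < n" for j
    using that by (cases "?g j = 0") (auto intro: span_base span_zero)
  have "norm (x k - ?s) *\<^sub>R ?g k + ?s \<in> span (?g ` {..<n} - {0})"
    using assms g by (intro span_add span_scale span_sum) auto
  moreover have "norm (x k - ?s) *\<^sub>R ?g k = x k - ?s"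
  proof -
    have "norm v *\<^sub>R sgn v = v" for v :: 'a by (cases "v = 0") (simp_all add: sgn_div_norm)
    then show ?thesis unfolding gram_schmidt.simps[of x k] .
  qed
  ultimately show ?thesis by simp
qed

lemma gram_schmidt_measurable:
  fixes x :: "'b \<Rightarrow> nat \<Rightarrow> 'a::euclidean_space"
  assumes [measurable]: "\<And>k. (\<lambda>w. x w k) \<in> borel_measurable M"
  shows "(\<lambda>w. gram_schmidt (x w) k) \<in> borel_measurable M"
proof (induction k rule: less_induct)
  case (less k)
  then have [measurable]: "(\<lambda>w. \<Sum>j<k. (gram_schmidt (x w) j \<bullet> x w k) *\<^sub>R gram_schmidt (x w) j)
      \<in> borel_measurable M"
    by (intro borel_measurable_sum borel_measurable_scaleR borel_measurable_inner) auto
  show ?case unfolding gram_schmidt.simps[of _ k] by measurable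
qed

text \<open>Gram-Schmidt and flags need the coordinates in some order, which a bare finite index
  type does not carry; one enumeration is fixed throughout.\<close>

abbreviation coord_index :: "'n::finite \<Rightarrow> nat" where
  "coord_index \<equiv> to_nat_on (UNIV :: 'n set)"

abbreviation coord :: "nat \<Rightarrow> 'n::finite" where
  "coord \<equiv> from_nat_into (UNIV :: 'n set)"

lemma coord_coord_index [simp]: "coord (coord_index i) = (i :: 'n::finite)"
  by (simp add: uncountable_infinite)

lemma coord_index_coord [simp]: "k < CARD('n) \<Longrightarrow> coord_index (coord k :: 'n::finite) = k"
  using to_nat_on_finite[of "UNIV :: 'n set"] by (intro to_nat_on_from_nat_into) (auto simp: bij_betw_def)

lemma coord_index_less [simp]: "coord_index (i :: 'n::finite) < CARD('n)"
  using to_nat_on_finite[of "UNIV :: 'n set"] by (auto simp: bij_betw_def)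

lemma coord_index_eq_iff [simp]: "coord_index i = coord_index j \<longleftrightarrow> i = (j :: 'n::finite)"
  by (metis coord_coord_index)

text \<open>A nonzero vector orthogonal to all \<open>x i\<close> would have all its coordinates too small.\<close>

lemma gram_schmidt_nonzero_near_basis:
  fixes x :: "'n::finite \<Rightarrow> real ^ 'n"
  assumes x: "\<And>i. norm (x i - axis i 1) < 1 / CARD('n)"
  shows "gram_schmidt (x \<circ> coord) (coord_index (j::'n)) \<noteq> 0"
proof
  let ?g = "gram_schmidt (x \<circ> coord)" and ?n = "CARD('n)"
  let ?S = "?g ` {..<?n} - {0}"
  assume "?g (coord_index j) = 0"
  then have "?S \<subseteq> ?g ` ({..<?n} - {coord_index j})" by auto
  then have "card ?S \<le> card ({..<?n} - {coord_index j})"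
    by (meson card_image_le card_mono finite_Diff finite_imageI finite_lessThan le_trans)
  also have "\<dots> < ?n" by simp
  finally have "dim ?S < DIM(real ^ 'n)"
    using dim_le_card'[of ?S] by simp
  then obtain y where y: "y \<noteq> 0" "\<And>v. v \<in> span ?S \<Longrightarrow> orthogonal y v"
    using orthogonal_to_subspace_exists by blast
  have *: "\<bar>y $ i\<bar> < norm y / ?n" for i
  proof -
    have "x i \<in> span ?S" using in_span_gram_schmidt[of "coord_index i" ?n "x \<circ> coord"] by simp
    then have "y \<bullet> x i = 0" using y by (simp add: orthogonal_def)
    then have "y $ i = - (y \<bullet> (x i - axis i 1))" by (simp add: inner_diff_right inner_axis)
    then have "\<bar>y $ i\<bar> \<le> norm y * norm (x i - axis i 1)"
      by (simp add: Cauchy_Schwarz_ineq2)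
    also have "\<dots> < norm y * (1 / ?n)" using x y by (intro mult_strict_left_mono) auto
    finally show ?thesis by simp
  qed
  have "norm y \<le> (\<Sum>i\<in>UNIV. \<bar>y $ i\<bar>)" by (rule norm_le_l1_cart)
  also have "\<dots> < (\<Sum>i\<in>(UNIV::'n set). norm y / ?n)" using * by (intro sum_strict_mono) auto
  also have "\<dots> = norm y" by simp
  finally show False by simp
qed

section \<open>Borel measurability of matrix operations\<close>

lemma borel_measurable_matrix:
  fixes f :: "'a \<Rightarrow> real ^ 'n ^ 'm"
  assumes "\<And>i j. (\<lambda>w. f w $ i $ j) \<in> borel_measurable M"
  shows "f \<in> borel_measurable M"
proof (rule borel_measurable_euclidean_space[THEN iffD2], rule ballI)
  fix b :: "real ^ 'n ^ 'm" assume "b \<in> Basis"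
  then obtain i j where "b = axis i (axis j 1)" by (auto simp: Basis_vec_def)
  then show "(\<lambda>w. f w \<bullet> b) \<in> borel_measurable M" using assms[of i j] by (simp add: inner_axis)
qed

lemma borel_measurable_matrix_nth [measurable (raw)]:
  fixes f :: "'a \<Rightarrow> real ^ 'n ^ 'm"
  assumes "f \<in> borel_measurable M"
  shows "(\<lambda>w. f w $ i $ j) \<in> borel_measurable M"
proof -
  have "(\<lambda>A::real ^ 'n ^ 'm. A $ i $ j) \<in> borel_measurable borel"
    by (intro borel_measurable_continuous_onI continuous_intros)
  then show ?thesis using assms measurable_compose by fast
qed

lemma borel_measurable_matrix_mult [measurable (raw)]:
  fixes f :: "'a \<Rightarrow> real ^ 'n ^ 'm" and g :: "'a \<Rightarrow> real ^ 'k ^ 'n"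
  assumes [measurable]: "f \<in> borel_measurable M" "g \<in> borel_measurable M"
  shows "(\<lambda>w. f w ** g w) \<in> borel_measurable M"
  by (rule borel_measurable_matrix) (simp add: matrix_matrix_mult_def)

lemma borel_measurable_transpose [measurable (raw)]:
  fixes f :: "'a \<Rightarrow> real ^ 'n ^ 'm"
  assumes [measurable]: "f \<in> borel_measurable M"
  shows "(\<lambda>w. transpose (f w)) \<in> borel_measurable M"
  by (rule borel_measurable_matrix) (simp add: transpose_def)

lemma linear_borel_measurable:
  fixes f :: "'a::euclidean_space \<Rightarrow> 'b::euclidean_space"
  assumes "linear f"
  shows "f \<in> borel_measurable borel"
  using assms
  by (intro borel_measurable_continuous_onI linear_continuous_on) (simp add: linear_conv_bounded_linear)

section \<open>A rotation-invariant probability law on Euclidean space\<close>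

lemma emeasure_lborel_ball_nontrivial:
  assumes "0 < r"
  shows "emeasure lborel (ball (a::'a::euclidean_space) r) \<noteq> 0"
    and "emeasure lborel (ball a r) \<noteq> \<infinity>"
proof -
  have "measure lborel (ball a r) > 0" using assms by simp
  then show "emeasure lborel (ball a r) \<noteq> 0" by (auto simp: measure_def)
  show "emeasure lborel (ball a r) \<noteq> \<infinity>" using emeasure_bounded_finite[of "ball a r"] by auto
qed

text \<open>
  The library states the invariance of Lebesgue measure under orthogonal maps only for well-ordered
  index types; every finite type has a well-ordered copy.
\<close>

typedef (overloaded) 'a wo_copy = "UNIV :: 'a::finite set" by blast

instance wo_copy :: (finite) finite
proof
  have "surj (Abs_wo_copy :: 'a \<Rightarrow> 'a wo_copy)" by (metis Rep_wo_copy_inverse surjI)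
  then show "finite (UNIV :: 'a wo_copy set)" by (metis finite finite_imageI)
qed

instantiation wo_copy :: (finite) wellorder
begin

definition "less_eq_wo_copy (i :: 'a wo_copy) (j :: 'a wo_copy) \<longleftrightarrow> coord_index (Rep_wo_copy i) \<le> coord_index (Rep_wo_copy j)"
definition "less_wo_copy (i :: 'a wo_copy) (j :: 'a wo_copy) \<longleftrightarrow> coord_index (Rep_wo_copy i) < coord_index (Rep_wo_copy j)"

instance
proof
  fix P :: "'a wo_copy \<Rightarrow> bool" and a :: "'a wo_copy"
  assume step: "\<And>i. (\<And>j. j < i \<Longrightarrow> P j) \<Longrightarrow> P i"
  show "P a"
    by (induction a rule: measure_induct_rule[of "\<lambda>i. coord_index (Rep_wo_copy i)"])
      (rule step, simp add: less_wo_copy_def)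
qed (auto simp: less_eq_wo_copy_def less_wo_copy_def Rep_wo_copy_inject)

end

text \<open>Orthogonal maps preserve both Lebesgue measure and balls about the origin;
  \<open>ball 0 r \<inter> A\<close> is the image under \<open>h\<close> of its own preimage in the
  ball.\<close>

lemma distr_uniform_ball_orthogonal:
  fixes h :: "real ^ 'n::{finite,wellorder} \<Rightarrow> real ^ 'n::_"
    and r :: real
  assumes h: "orthogonal_transformation h"
  defines "B \<equiv> uniform_measure lborel (ball 0 r)"
  shows "distr B B h = B"
proof (rule measure_eqI)
  have hm[measurable]: "h \<in> borel_measurable borel"
    by (intro linear_borel_measurable orthogonal_transformation_linear h)
  fix A assume "A \<in> sets (distr B B h)"
  then have A[measurable]: "A \<in> sets borel" by (simp add: B_def)
  have vA[measurable]: "h -` A \<in> sets borel" using measurable_sets[OF hm A] by simp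
  let ?S = "ball 0 r \<inter> h -` A"
  have "h ` ?S = ball 0 r \<inter> A"
  proof -
    have "h ` (ball 0 r \<inter> h -` A) = h ` ball 0 r \<inter> A" by auto
    then show ?thesis using image_orthogonal_transformation_ball[OF h, of 0 r]
        orthogonal_transformation_linear[OF h] by (simp add: linear_0)
  qed
  moreover have S: "?S \<in> lmeasurable"
    by (intro bounded_set_imp_lmeasurable) (auto intro: bounded_subset[OF bounded_ball])
  ultimately have "measure lebesgue (ball 0 r \<inter> A) = measure lebesgue ?S" "ball 0 r \<inter> A \<in> lmeasurable"
    using measure_orthogonal_image[OF h S] measurable_orthogonal_image[OF h S] by auto
  then have "emeasure lebesgue (ball 0 r \<inter> A) = emeasure lebesgue ?S"
    using S by (simp add: emeasure_eq_measure2 fmeasurableD2 emeasure_eq_ennreal_measure)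
  then have "emeasure lborel (ball 0 r \<inter> A) = emeasure lborel ?S" by simp
  then show "emeasure (distr B B h) A = emeasure B A"
    by (simp add: B_def emeasure_distr)
qed (simp add: B_def)

text \<open>The uniform law on a ball serves. Radius 2 leaves room for the balls of radius
  \<open>1 / CARD('n)\<close> about the standard basis vectors, which must get positive mass
  later.\<close>

lemma rotation_invariant_measure_exists:
  "\<exists>B :: (real ^ 'n) measure. prob_space B \<and> sets B = sets borel \<and>
     (\<forall>h. orthogonal_transformation h \<longrightarrow> distr B B h = B) \<and>
     (\<forall>a r. 0 < r \<longrightarrow> ball a r \<subseteq> ball 0 2 \<longrightarrow> emeasure B (ball a r) \<noteq> 0)"
proof -
  let ?L = "uniform_measure lborel (ball 0 2) :: (real ^ 'n wo_copy) measure"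
  \<comment> \<open>Relabelling coordinates is a linear isometry, so invariance under
    \<open>h\<close> transfers from invariance of the copy under the conjugate
    \<open>\<kappa> \<circ> h \<circ> \<iota>\<close>.\<close>
  define \<iota> :: "real ^ 'n wo_copy \<Rightarrow> real ^ 'n" where "\<iota> x = (\<chi> i. x $ Abs_wo_copy i)" for x
  define \<kappa> :: "real ^ 'n \<Rightarrow> real ^ 'n wo_copy" where "\<kappa> y = (\<chi> i. y $ Rep_wo_copy i)" for y
  have inv[simp]: "\<iota> (\<kappa> y) = y" "\<kappa> (\<iota> x) = x" for x y
    by (simp_all add: \<iota>_def \<kappa>_def vec_eq_iff Rep_wo_copy_inverse Abs_wo_copy_inverse)
  have lin: "linear \<iota>" "linear \<kappa>"
    by (auto simp: \<iota>_def \<kappa>_def vec_eq_iff intro!: linearI)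
  have "bij_betw Abs_wo_copy (UNIV :: 'n set) UNIV"
    by (rule bij_betwI[of _ _ _ Rep_wo_copy]) (auto simp: Rep_wo_copy_inverse Abs_wo_copy_inverse)
  then have inner_\<iota>: "\<iota> x \<bullet> \<iota> y = x \<bullet> y" for x y
    unfolding inner_vec_def \<iota>_def by (simp add: sum.reindex_bij_betw[of _ _ _ "\<lambda>i. x $ i * y $ i"])
  then have inner_\<kappa>: "\<kappa> x \<bullet> \<kappa> y = x \<bullet> y" for x y by (metis inv(1))
  have norm_\<iota>: "norm (\<iota> x) = norm x" for x by (simp add: norm_eq_sqrt_inner inner_\<iota>)
  have meas[measurable]: "\<iota> \<in> borel_measurable borel"
    by (intro linear_borel_measurable lin)
  define B where "B = distr ?L borel \<iota>"
  have pL: "prob_space ?L"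
    by (rule prob_space_uniform_measure) (use emeasure_lborel_ball_nontrivial[of 2] in auto)
  have "prob_space B" unfolding B_def by (rule prob_space.prob_space_distr[OF pL]) simp
  moreover have "sets B = sets borel" by (simp add: B_def)
  moreover have "distr B B h = B" if h: "orthogonal_transformation h" for h
  proof -
    have hm[measurable]: "h \<in> borel_measurable borel"
      by (intro linear_borel_measurable orthogonal_transformation_linear h)
    let ?h = "\<kappa> \<circ> h \<circ> \<iota>"
    have "linear ?h" using lin orthogonal_transformation_linear[OF h] by (intro linear_compose)
    then have h': "orthogonal_transformation ?h"
      using h by (simp add: orthogonal_transformation_def inner_\<iota> inner_\<kappa>)
    then have hm': "?h \<in> borel_measurable borel"
      by (intro linear_borel_measurable orthogonal_transformation_linear h')
    have "distr B B h = distr (distr ?L borel \<iota>) borel h"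
      unfolding B_def by (rule distr_cong) auto
    also have "\<dots> = distr ?L borel (h \<circ> \<iota>)" by (rule distr_distr) auto
    also have "h \<circ> \<iota> = \<iota> \<circ> ?h" by (simp add: fun_eq_iff)
    also have "distr ?L borel (\<iota> \<circ> ?h) = distr (distr ?L ?L ?h) borel \<iota>"
      by (rule distr_distr[symmetric]) (use hm' meas in \<open>simp_all add: measurable_def\<close>)
    also have "\<dots> = B" unfolding distr_uniform_ball_orthogonal[OF h'] B_def ..
    finally show ?thesis .
  qed
  moreover have "emeasure B (ball a r) \<noteq> 0" if r: "0 < r" and sub: "ball a r \<subseteq> ball 0 2" for a r
  proof -
    have v: "\<iota> -` ball a r = ball (\<kappa> a) r"
    proof -
      have "dist a (\<iota> x) = dist (\<kappa> a) x" for x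
        using norm_\<iota>[of "\<kappa> a - x"] by (simp add: dist_norm linear_diff[OF lin(1)])
      then show ?thesis by auto
    qed
    have "ball (\<kappa> a) r \<subseteq> ball 0 2"
    proof
      fix x assume "x \<in> ball (\<kappa> a) r"
      then have "\<iota> x \<in> ball a r" using v by auto
      then show "x \<in> ball 0 2" using sub norm_\<iota>[of x] by auto
    qed
    then have "ball 0 2 \<inter> ball (\<kappa> a) r = ball (\<kappa> a) r" by blast
    then show ?thesis
      using r emeasure_lborel_ball_nontrivial[OF r, of "\<kappa> a"]
        emeasure_lborel_ball_nontrivial[of 2 "0 :: real ^ 'n wo_copy"]
      by (simp add: B_def emeasure_distr v ennreal_divide_eq_0_iff)
  qed
  ultimately show ?thesis by blast
qed

section \<open>Construction of a left-invariant probability measure\<close>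

lemma orthogonal_transformation_matrix_vector_mult:
  "orthogonal_matrix (h :: real ^ 'n ^ 'n) \<Longrightarrow> orthogonal_transformation ((*v) h)"
  by (simp add: orthogonal_transformation_matrix matrix_of_matrix_vector_mul)

abbreviation orthogonal_group_borel :: "(real ^ 'n ^ 'n) measure" where
  "orthogonal_group_borel \<equiv> restrict_space borel {g. orthogonal_matrix g}"

text \<open>Draw the columns independently from a rotation-invariant law, condition on nondegeneracy
  and orthonormalise. Left multiplication by \<open>h\<close> applies \<open>h\<close> to every
  column, which changes neither the joint law nor the condition and commutes with
  Gram-Schmidt.\<close>

lemma haar_exists:
  "\<exists>\<mu> :: (real ^ 'n ^ 'n) measure. prob_space \<mu> \<and> sets \<mu> = sets orthogonal_group_borel \<and>
     (\<forall>h. orthogonal_matrix h \<longrightarrow> distr \<mu> \<mu> (\<lambda>g. h ** g) = \<mu>)"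
proof -
  obtain B :: "(real ^ 'n) measure" where pB: "prob_space B" and B_sets: "sets B = sets borel"
    and B_inv: "\<And>h. orthogonal_transformation h \<Longrightarrow> distr B B h = B"
    and B_pos: "\<And>a r. 0 < r \<Longrightarrow> ball a r \<subseteq> ball 0 2 \<Longrightarrow> emeasure B (ball a r) \<noteq> 0"
    using rotation_invariant_measure_exists by blast
  interpret PP: product_prob_space "\<lambda>_::'n. B" by (intro product_prob_spaceI pB)
  define \<Omega> where "\<Omega> = PiM (UNIV :: 'n set) (\<lambda>_. B)"
  have sB[measurable_cong]: "sets B = sets borel" "space B = UNIV"
    using B_sets sets_eq_imp_space_eq[OF B_sets] by simp_all
  have space\<Omega>: "space \<Omega> = UNIV" by (simp add: \<Omega>_def space_PiM sB)
  let ?gs = "\<lambda>X :: 'n \<Rightarrow> real ^ 'n. \<lambda>j::'n. gram_schmidt (X \<circ> coord) (coord_index j)"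
  define good where "good = {X :: 'n \<Rightarrow> real ^ 'n. \<forall>j. ?gs X j \<noteq> 0}"
  \<comment> \<open>The default \<open>mat 1\<close> makes \<open>frame\<close> map into the
    orthogonal group everywhere; after conditioning, the degenerate inputs carry no mass.\<close>
  define frame :: "('n \<Rightarrow> real ^ 'n) \<Rightarrow> real ^ 'n ^ 'n" where
    "frame = (\<lambda>X. if X \<in> good then \<chi> i j. ?gs X j $ i else mat 1)"
  have gs_meas[measurable]: "(\<lambda>X. ?gs X j) \<in> borel_measurable \<Omega>" for j
    unfolding \<Omega>_def by (rule gram_schmidt_measurable) simp
  have good_meas[measurable]: "good \<in> sets \<Omega>"
  proof -
    have "{X \<in> space \<Omega>. \<forall>j. ?gs X j \<noteq> 0} \<in> sets \<Omega>" by measurable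
    then show ?thesis by (simp add: good_def space\<Omega>)
  qed
  have frame_meas[measurable]: "frame \<in> borel_measurable \<Omega>"
    unfolding frame_def
  proof (rule measurable_If_set)
    show "(\<lambda>X. \<chi> i j. ?gs X j $ i) \<in> borel_measurable \<Omega>"
      by (rule borel_measurable_matrix) (simp add: measurable_compose[OF gs_meas borel_measurable_nth])
  qed simp_all
  have frame_orth: "orthogonal_matrix (frame X)" for X
  proof (cases "X \<in> good")
    case True
    have c: "column j (frame X) = ?gs X j" for j using True by (simp add: frame_def column_def)
    show ?thesis
      unfolding orthogonal_matrix_orthonormal_columns c
      using True by (auto simp: good_def orthogonal_def norm_gram_schmidt gram_schmidt_orthogonal)
  qed (simp add: frame_def orthogonal_matrix_id)
  \<comment> \<open>By independence the product of small balls around the basis vectors has positive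
    probability, and on it Gram-Schmidt does not degenerate. Positive probability is enough to
    condition on \<open>good\<close>.\<close>
  have good_pos: "emeasure \<Omega> good \<noteq> 0"
  proof -
    let ?N = "\<lambda>i::'n. ball (axis i 1 :: real ^ 'n) (1 / CARD('n))"
    have "emeasure B (?N i) \<noteq> 0" for i
    proof -
      have "?N i \<subseteq> ball 0 2"
      proof
        fix v assume v: "v \<in> ?N i"
        have "norm v \<le> norm (axis i 1 :: real ^ 'n) + dist (axis i 1) v"
          by (metis dist_norm norm_minus_commute norm_triangle_sub)
        moreover have "dist (axis i 1) v < 1 / CARD('n)" using v by simp
        moreover have "1 / real CARD('n) \<le> 1" by simp
        ultimately have "norm v < 2" unfolding norm_axis_1 by linarith
        then show "v \<in> ball 0 2" by simp
      qed
      then show ?thesis by (intro B_pos) auto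
    qed
    then have "emeasure \<Omega> (PiE UNIV ?N) \<noteq> 0"
      unfolding \<Omega>_def by (subst PP.emeasure_PiM) (auto simp: sB)
    moreover have "PiE UNIV ?N \<subseteq> good"
      unfolding good_def
    proof (intro subsetI CollectI allI)
      fix X j assume X: "X \<in> PiE UNIV ?N"
      have "norm (X i - axis i 1) < 1 / CARD('n)" for i
        using PiE_mem[OF X, of i] by (simp add: dist_norm norm_minus_commute)
      then show "?gs X j \<noteq> 0" by (rule gram_schmidt_nonzero_near_basis)
    qed
    ultimately show ?thesis using emeasure_mono[OF _ good_meas, of "PiE UNIV ?N"] by auto
  qed
  have good_fin: "emeasure \<Omega> good \<noteq> \<infinity>" 
  proof -
    have "prob_space \<Omega>" unfolding \<Omega>_def by (intro prob_space_PiM pB)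
    then show ?thesis using finite_measure.emeasure_finite[OF prob_space.axioms(1)] by simp
  qed
  define U where "U = uniform_measure \<Omega> good"
  have pU: "prob_space U" unfolding U_def by (rule prob_space_uniform_measure) (fact good_pos good_fin)+
  have U_sets[measurable_cong]: "sets U = sets \<Omega>" by (simp add: U_def)
  have U_space: "space U = UNIV" by (simp add: U_def space\<Omega>)
  define \<mu> where "\<mu> = distr U orthogonal_group_borel frame"
  have frameU[measurable]: "frame \<in> measurable U orthogonal_group_borel"
    by (intro measurable_restrict_space2) (auto simp: frame_orth)
  have "distr \<mu> \<mu> (\<lambda>g. h ** g) = \<mu>" if h: "orthogonal_matrix h" for h
  proof (rule measure_eqI)
    let ?T = "\<lambda>(X :: 'n \<Rightarrow> real ^ 'n) i. h *v X i"
    have ho: "orthogonal_transformation ((*v) h)" using h by (rule orthogonal_transformation_matrix_vector_mult)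
    have inj: "h *v v = 0 \<longleftrightarrow> v = 0" for v
      using orthogonal_transformation_norm[OF ho, of v] by auto
    have gsT: "?gs (?T X) j = h *v ?gs X j" for X j
      using gram_schmidt_orthogonal_transformation[OF ho, of "X \<circ> coord"] by (simp add: o_def)
    have goodT: "?T X \<in> good \<longleftrightarrow> X \<in> good" for X unfolding good_def mem_Collect_eq gsT inj ..
    have frameT: "frame (?T X) = h ** frame X" if "X \<in> good" for X
      unfolding frame_def goodT gsT
      using that by (simp add: vec_eq_iff matrix_matrix_mult_def matrix_vector_mult_def)
    have hm[measurable]: "(\<lambda>g. h ** g) \<in> measurable \<mu> \<mu>"
      unfolding \<mu>_def measurable_distr_eq1 measurable_distr_eq2
      by (intro measurable_restrict_space2 measurable_restrict_space1)
         (auto simp: space_restrict_space orthogonal_matrix_mul h)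
    have hB: "(*v) h \<in> measurable B B"
      unfolding measurable_cong_sets[OF sB(1) sB(1)] by (rule linear_borel_measurable) simp
    have Tm[measurable]: "?T \<in> measurable \<Omega> \<Omega>"
      unfolding \<Omega>_def
      by (rule measurable_PiM_single')
         (auto simp: sB space_PiM intro!: measurable_compose[OF _ hB])
    have T_inv: "distr \<Omega> \<Omega> ?T = \<Omega>"
    proof -
      have "distr \<Omega> \<Omega> (compose UNIV ((*v) h)) = PiM UNIV (\<lambda>i. distr B B ((*v) h))"
        unfolding \<Omega>_def
        by (rule distr_PiM_finite_prob_space)
           (auto intro!: product_prob_spaceI pB hB)
      moreover have "compose UNIV ((*v) h) = ?T" by (simp add: fun_eq_iff compose_def)
      ultimately show ?thesis unfolding B_inv[OF ho] by (simp add: \<Omega>_def)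
    qed
    fix A assume "A \<in> sets (distr \<mu> \<mu> (\<lambda>g. h ** g))"
    then have A[measurable]: "A \<in> sets \<mu>" by simp
    then have A'[measurable]: "A \<in> sets orthogonal_group_borel" by (simp add: \<mu>_def)
    have FA[measurable]: "frame -` A \<in> sets \<Omega>"
      using measurable_sets[OF frameU A'] U_sets U_space by simp
    have hA: "(\<lambda>g. h ** g) -` A \<inter> space \<mu> \<in> sets \<mu>" by measurable
    have "emeasure (distr \<mu> \<mu> (\<lambda>g. h ** g)) A = emeasure \<mu> ((\<lambda>g. h ** g) -` A \<inter> space \<mu>)"
      by (simp add: emeasure_distr)
    also have "\<dots> = emeasure U (frame -` ((\<lambda>g. h ** g) -` A \<inter> space \<mu>))"
      using hA by (simp add: \<mu>_def emeasure_distr U_space)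
    also have "\<dots> = emeasure \<Omega> (good \<inter> frame -` ((\<lambda>g. h ** g) -` A \<inter> space \<mu>)) / emeasure \<Omega> good"
      unfolding U_def using measurable_sets[OF frameU, of "(\<lambda>g. h ** g) -` A \<inter> space \<mu>"] hA U_sets U_space
      by (subst emeasure_uniform_measure) (auto simp: \<mu>_def)
    \<comment> \<open>Equivariance of \<open>frame\<close> and invariance of \<open>good\<close>
      turn left translation of matrices into the map \<open>?T\<close> on columns, which preserves
      \<Omega>.\<close>
    also have "good \<inter> frame -` ((\<lambda>g. h ** g) -` A \<inter> space \<mu>) = ?T -` (good \<inter> frame -` A) \<inter> space \<Omega>"
      using frameT goodT frame_orth by (auto simp: \<mu>_def space_restrict_space space\<Omega>)
    also have "emeasure \<Omega> \<dots> = emeasure (distr \<Omega> \<Omega> ?T) (good \<inter> frame -` A)"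
      by (subst emeasure_distr) auto
    also have "\<dots> / emeasure \<Omega> good = emeasure U (frame -` A)"
      unfolding T_inv U_def by (subst emeasure_uniform_measure) auto
    also have "\<dots> = emeasure \<mu> A"
      using A' by (simp add: \<mu>_def emeasure_distr U_space)
    finally show "emeasure (distr \<mu> \<mu> (\<lambda>g. h ** g)) A = emeasure \<mu> A" .
  qed simp
  moreover have "prob_space \<mu>" unfolding \<mu>_def using pU frameU by (rule prob_space.prob_space_distr)
  ultimately show ?thesis by (intro exI[of _ \<mu>]) (simp add: \<mu>_def)
qed

section \<open>The invariant measure on flags\<close>

lemma measurable_sets_mem:
  "f \<in> measurable M N \<Longrightarrow> A \<in> sets N \<Longrightarrow> {x \<in> space M. f x \<in> A} \<in> sets M"
  using measurable_sets[of f M N A] by (simp add: vimage_def Int_def conj_commute)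

section \<open>Orthogonal projections onto subspaces\<close>

text \<open>By Pythagoras. It reduces the identities for projections below to checking that a
  residual is orthogonal to the subspace.\<close>

lemma closest_point_subspace_eqI:
  fixes S :: "'a::euclidean_space set"
  assumes "subspace S" "p \<in> S" "\<And>s. s \<in> S \<Longrightarrow> (x - p) \<bullet> s = 0"
  shows "closest_point S x = p"
proof (rule closest_point_unique[symmetric])
  show "\<forall>z\<in>S. dist x p \<le> dist x z"
  proof
    fix z assume "z \<in> S"
    then have "(x - p) \<bullet> (p - z) = 0" using assms by (simp add: subspace_diff)
    then have "(norm (x - z))\<^sup>2 = (norm (x - p))\<^sup>2 + (norm (p - z))\<^sup>2"
      using norm_add_Pythagorean[of "x - p" "p - z"] by (simp add: orthogonal_def)
    then have "(norm (x - p))\<^sup>2 \<le> (norm (x - z))\<^sup>2" by simp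
    then show "dist x p \<le> dist x z" by (simp add: dist_norm)
  qed
qed (use assms in \<open>auto intro: subspace_imp_convex closed_subspace\<close>)

lemma closest_point_subspace:
  fixes S :: "'a::euclidean_space set"
  assumes "subspace S"
  shows "closest_point S x \<in> S" and "s \<in> S \<Longrightarrow> (x - closest_point S x) \<bullet> s = 0"
proof -
  obtain p z where pz: "p \<in> span S" "\<And>w. w \<in> span S \<Longrightarrow> orthogonal z w" "x = p + z"
    using orthogonal_subspace_decomp_exists by blast
  then have "closest_point S x = p"
    using assms by (intro closest_point_subspace_eqI) (auto simp: span_eq_iff[THEN iffD2] orthogonal_def)
  with pz assms show "closest_point S x \<in> S" "s \<in> S \<Longrightarrow> (x - closest_point S x) \<bullet> s = 0"
    by (auto simp: span_eq_iff[THEN iffD2] orthogonal_def)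
qed

lemma linear_closest_point_subspace:
  fixes S :: "'a::euclidean_space set"
  assumes S: "subspace S"
  shows "linear (closest_point S)"
proof (rule linearI)
  fix x y and c :: real
  show "closest_point S (x + y) = closest_point S x + closest_point S y"
    using S closest_point_subspace[OF S]
    by (intro closest_point_subspace_eqI)
       (auto simp: subspace_add add_diff_add inner_add_left)
  show "closest_point S (c *\<^sub>R x) = c *\<^sub>R closest_point S x"
    using S closest_point_subspace[OF S]
    by (intro closest_point_subspace_eqI)
       (auto simp: subspace_scale scaleR_diff_right[symmetric])
qed

text \<open>Projections transform by conjugation, because \<open>g\<close> preserves inner products
  and its inverse is its transpose.\<close>

lemma closest_point_orthogonal_image:
  fixes g :: "real ^ 'n ^ 'n"
  assumes g: "orthogonal_matrix g" and S: "subspace S"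
  shows "closest_point ((*v) g ` S) x = g *v closest_point S (transpose g *v x)"
proof (rule closest_point_subspace_eqI)
  show "subspace ((*v) g ` S)" using S by (intro linear_subspace_image) simp_all
  show "g *v closest_point S (transpose g *v x) \<in> (*v) g ` S" using closest_point_subspace[OF S] by blast
  fix s assume "s \<in> (*v) g ` S"
  then obtain u where u: "u \<in> S" "s = g *v u" by blast
  have "x = g *v (transpose g *v x)"
    using g by (simp only: matrix_vector_mul_assoc orthogonal_matrix_def matrix_vector_mul_lid)
  then have "(x - g *v closest_point S (transpose g *v x)) \<bullet> s
      = (g *v (transpose g *v x - closest_point S (transpose g *v x))) \<bullet> (g *v u)"
    using u by (simp add: matrix_vector_mult_diff_distrib)
  also have "\<dots> = (transpose g *v x - closest_point S (transpose g *v x)) \<bullet> u"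
    using orthogonal_transformation_matrix_vector_mult[OF g] by (simp add: orthogonal_transformation_def)
  also have "\<dots> = 0" using closest_point_subspace(2)[OF S u(1)] .
  finally show "(x - g *v closest_point S (transpose g *v x)) \<bullet> s = 0" .
qed

lemma orthogonal_matrix_cancel [simp]:
  fixes g :: "real ^ 'n ^ 'n"
  assumes "orthogonal_matrix g"
  shows "transpose g ** g = mat 1" "g ** transpose g = mat 1"
  using assms by (auto simp: orthogonal_matrix_def)

section \<open>Flags as projection matrices and the orthogonal action\<close>

text \<open>The coordinates of \<open>flag_topology\<close> are indexed by a level and a vector,
  hence uncountable in number. One matrix per level leaves a countable product, where measurability
  can be checked coordinatewise.\<close>

definition flag_proj :: "(nat \<Rightarrow> (real ^ 'n) set) \<Rightarrow> nat \<Rightarrow> real ^ 'n ^ 'n" where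
  "flag_proj F k = matrix (closest_point (F k))"

abbreviation act :: "real ^ 'n ^ 'n \<Rightarrow> (nat \<Rightarrow> (real ^ 'n) set) \<Rightarrow> nat \<Rightarrow> (real ^ 'n) set" where
  "act g \<equiv> flag_act ((*v) g)"

lemma subspace_flag: "F \<in> flags \<Longrightarrow> k \<le> CARD('n) \<Longrightarrow> subspace (F k :: (real ^ 'n) set)"
  by (auto simp: flags_def Mod_def)

lemma act_mult: "act (g ** h) F = act g (act h F)"
  by (auto simp: flag_act_def fun_eq_iff image_image matrix_vector_mul_assoc)

lemma act_id: "F \<in> flags \<Longrightarrow> act (mat 1) F = F"
  by (auto simp: flag_act_def flags_def fun_eq_iff PiE_def extensional_def)

lemma act_in_flags:
  fixes F :: "nat \<Rightarrow> (real ^ 'n) set"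
  assumes g: "orthogonal_matrix g" and F: "F \<in> flags"
  shows "act g F \<in> flags"
proof -
  have inj: "inj ((*v) g)"
    using orthogonal_transformation_matrix_vector_mult[OF g] by (rule orthogonal_transformation_inj)
  have "dim ((*v) g ` F k) = dim (F k)" for k
    by (rule dim_image_eq) (use inj in \<open>auto intro: inj_on_subset\<close>)
  then show ?thesis
    using F by (simp add: flag_act_def flags_def Mod_def linear_subspace_image image_mono PiE_iff)
qed

lemma act_transpose_cancel [simp]:
  assumes "orthogonal_matrix g" "F \<in> flags"
  shows "act (transpose g) (act g F) = F" "act g (act (transpose g) F) = F"
  using assms by (simp_all add: act_mult[symmetric] act_id)

text \<open>Invariance of a measure is stated with images; as preimages under the inverse they are
  covered by measurability of the action.\<close>

lemma act_image:
  assumes g: "orthogonal_matrix g" and A: "A \<subseteq> flags"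
  shows "act g ` A = {F \<in> flags. act (transpose g) F \<in> A}"
proof safe
  fix F assume "F \<in> A"
  then show "act g F \<in> flags" "act (transpose g) (act g F) \<in> A"
    using assms by (auto simp: act_in_flags subset_iff)
next
  fix F assume "F \<in> flags" "act (transpose g) F \<in> A"
  then show "F \<in> act g ` A" using g by (metis act_transpose_cancel(2) imageI)
qed

text \<open>Conjugation is polynomial in the entries of \<open>g\<close>, which gives joint
  measurability of the action. Above level \<open>n\<close> flags take the value
  \<open>undefined\<close>, so the matrix there is a constant.\<close>

lemma flag_proj_act:
  assumes g: "orthogonal_matrix g" and F: "F \<in> flags"
  shows "flag_proj (act g F) k =
    (if k \<le> CARD('n) then g ** flag_proj F k ** transpose g
     else matrix (closest_point undefined) :: real ^ 'n ^ 'n)"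
proof (cases "k \<le> CARD('n)")
  case True
  note S = subspace_flag[OF F True]
  have "closest_point (act g F k) = (*v) g \<circ> closest_point (F k) \<circ> (*v) (transpose g)"
    using True closest_point_orthogonal_image[OF g S] by (simp add: flag_act_def fun_eq_iff)
  then show ?thesis
    using True linear_closest_point_subspace[OF S]
    by (simp add: flag_proj_def matrix_compose matrix_vector_mul_linear linear_compose matrix_of_matrix_vector_mul)
qed (simp add: flag_proj_def flag_act_def)

section \<open>The Borel structure on flags\<close>

definition flag_borel :: "(nat \<Rightarrow> (real ^ 'n) set) measure" where
  "flag_borel = sigma flags {U. openin flag_topology U}"

text \<open>A projection and its matrix determine each other, and both passages are continuous for
  pointwise convergence: \<open>J\<close> goes from matrices to maps, \<open>L\<close> from maps to
  matrices.\<close>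

lemma openin_flag_topology_iff:
  "openin flag_topology U \<longleftrightarrow>
     (\<exists>W :: (nat \<Rightarrow> real ^ 'n ^ 'n) set. open W \<and> U = flag_proj -` W \<inter> flags)"
proof
  let ?cp = "\<lambda>F k x. closest_point (F k) x :: real ^ 'n"
  assume "openin flag_topology U"
  then obtain V :: "(nat \<Rightarrow> real ^ 'n \<Rightarrow> real ^ 'n) set" where V: "open V" "U = ?cp -` V \<inter> flags"
    by (auto simp: flag_topology_def openin_pullback_topology)
  \<comment> \<open>\<open>closest_point undefined\<close> need not be linear, hence not recoverable
    from a matrix; levels above \<open>n\<close> therefore get it as a constant.\<close>
  define J :: "(nat \<Rightarrow> real ^ 'n ^ 'n) \<Rightarrow> nat \<Rightarrow> real ^ 'n \<Rightarrow> real ^ 'n"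
    where "J m k x = (if k \<le> CARD('n) then m k *v x else closest_point undefined x)" for m k x
  have "continuous_on UNIV (\<lambda>m. J m k x)" for k x
    unfolding J_def matrix_vector_mult_def
    by (cases "k \<le> CARD('n)") (auto intro!: continuous_intros continuous_on_product_coordinates)
  then have "continuous_on UNIV J"
    by (intro continuous_on_coordinatewise_then_product)
  then have "open (J -` V)" using V(1) by (simp add: continuous_on_open_vimage)
  moreover have "J (flag_proj F) = ?cp F" if "F \<in> flags" for F
  proof (intro ext)
    fix k x
    show "J (flag_proj F) k x = ?cp F k x"
      using linear_closest_point_subspace[OF subspace_flag[OF that]] that
      by (auto simp: J_def flag_proj_def flags_def PiE_def extensional_def)
  qed
  ultimately show "\<exists>W. open W \<and> U = flag_proj -` W \<inter> flags"
    using V(2) by (intro exI[of _ "J -` V"]) auto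
next
  let ?cp = "\<lambda>F k x. closest_point (F k) x :: real ^ 'n"
  assume "\<exists>W. open W \<and> U = flag_proj -` W \<inter> flags"
  then obtain W where W: "open W" "U = flag_proj -` W \<inter> flags" by blast
  define L :: "(nat \<Rightarrow> real ^ 'n \<Rightarrow> real ^ 'n) \<Rightarrow> nat \<Rightarrow> real ^ 'n ^ 'n"
    where "L f k = matrix (f k)" for f k
  have "continuous_on UNIV (\<lambda>f :: nat \<Rightarrow> real ^ 'n \<Rightarrow> real ^ 'n. f k x)" for k x
    by (rule continuous_on_product_then_coordinatewise[OF continuous_on_product_coordinates])
  then have "continuous_on UNIV (\<lambda>f. L f k)" for k
    unfolding L_def matrix_def by (intro continuous_intros)
  then have "continuous_on UNIV L" by (intro continuous_on_coordinatewise_then_product)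
  then have "open (L -` W)" using W(1) by (simp add: continuous_on_open_vimage)
  moreover have "L (?cp F) = flag_proj F" for F by (simp add: L_def flag_proj_def fun_eq_iff)
  ultimately show "openin flag_topology U"
    using W(2) by (auto simp: flag_topology_def openin_pullback_topology intro!: exI[of _ "L -` W"])
qed

lemma flag_borel_eq: "flag_borel = vimage_algebra flags (flag_proj :: _ \<Rightarrow> nat \<Rightarrow> real ^ 'n ^ 'n) borel"
proof -
  have "{U. openin flag_topology U}
      = {(flag_proj :: _ \<Rightarrow> nat \<Rightarrow> real ^ 'n ^ 'n) -` W \<inter> flags |W. W \<in> {W. open W}}"
    by (auto simp: openin_flag_topology_iff)
  then show ?thesis
    unfolding flag_borel_def borel_def by (subst vimage_algebra_sigma) auto
qed

lemma space_flag_borel [simp]: "space flag_borel = flags"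
  by (simp add: flag_borel_eq)

lemma sets_flag_borel: "sets flag_borel = sigma_sets flags {U. openin flag_topology U}"
  unfolding flag_borel_def by (rule sets_measure_of) (auto simp: openin_flag_topology_iff)

lemma flag_proj_measurable:
  "(\<lambda>F. flag_proj F k :: real ^ 'n ^ 'n) \<in> borel_measurable flag_borel"
proof -
  have "(flag_proj :: _ \<Rightarrow> nat \<Rightarrow> real ^ 'n ^ 'n) \<in> borel_measurable flag_borel"
    unfolding flag_borel_eq by (rule measurable_vimage_algebra1) simp
  moreover have "(\<lambda>m :: nat \<Rightarrow> real ^ 'n ^ 'n. m k) \<in> borel_measurable borel"
    by (intro borel_measurable_continuous_onI continuous_on_product_coordinates)
  ultimately show ?thesis by (rule measurable_compose)
qed

lemma measurable_flag_borelI: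
  fixes f :: "'a \<Rightarrow> nat \<Rightarrow> (real ^ 'n) set"
  assumes "f \<in> space N \<rightarrow> flags" "\<And>k. (\<lambda>w. flag_proj (f w) k) \<in> borel_measurable N"
  shows "f \<in> measurable N flag_borel"
  unfolding flag_borel_eq
  by (rule measurable_vimage_algebra2[OF assms(1)]) (rule measurable_coordinatewise_then_product[OF assms(2)])

lemma measurable_act:
  fixes f :: "'a \<Rightarrow> real ^ 'n ^ 'n"
  assumes f: "f \<in> borel_measurable N" "\<And>w. w \<in> space N \<Longrightarrow> orthogonal_matrix (f w)"
    and F: "F \<in> measurable N flag_borel"
  shows "(\<lambda>w. act (f w) (F w)) \<in> measurable N flag_borel"
proof (rule measurable_flag_borelI)
  have sp: "F w \<in> flags" if "w \<in> space N" for w using measurable_space[OF F that] by simp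
  then show "(\<lambda>w. act (f w) (F w)) \<in> space N \<rightarrow> flags" using f by (auto intro: act_in_flags)
  fix k
  note [measurable] = f(1) measurable_compose[OF F flag_proj_measurable]
  have "(\<lambda>w. if k \<le> CARD('n) then f w ** flag_proj (F w) k ** transpose (f w)
      else matrix (closest_point undefined)) \<in> borel_measurable N" by measurable
  then show "(\<lambda>w. flag_proj (act (f w) (F w)) k) \<in> borel_measurable N"
    by (rule measurable_cong[THEN iffD2, rotated]) (use f sp in \<open>simp add: flag_proj_act\<close>)
qed

section \<open>Transitivity of the action on flags\<close>

definition std_flag :: "nat \<Rightarrow> (real ^ 'n) set" where
  "std_flag = (\<lambda>k\<in>{..CARD('n)}. span ((\<lambda>j. axis (coord j) 1) ` {..<k}))"

lemma span_orthonormal: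
  fixes e :: "nat \<Rightarrow> 'a::euclidean_space"
  assumes "\<And>j. j < k \<Longrightarrow> norm (e j) = 1" "\<And>i j. i < k \<Longrightarrow> j < k \<Longrightarrow> i \<noteq> j \<Longrightarrow> e i \<bullet> e j = 0"
  shows "dim (span (e ` {..<k})) = k"
proof -
  have "inj_on e {..<k}"
    using assms by (intro inj_onI) (metis lessThan_iff inner_eq_zero_iff norm_zero zero_neq_one)
  moreover have "independent (e ` {..<k})"
    using assms
    by (intro pairwise_orthogonal_independent) (auto simp: pairwise_def orthogonal_def, metis norm_zero zero_neq_one)
  ultimately show ?thesis by (simp add: dim_eq_card_independent card_image)
qed

lemma std_flag_in_flags: "(std_flag :: nat \<Rightarrow> (real ^ 'n) set) \<in> flags"
proof -
  have "dim (span ((\<lambda>j. axis (coord j) 1 :: real ^ 'n) ` {..<k})) = k" if "k \<le> CARD('n)" for k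
  proof (rule span_orthonormal)
    fix i j assume "i < k" "j < k" "i \<noteq> j"
    then have "coord i \<noteq> (coord j :: 'n)" using that coord_index_coord by (metis order_less_le_trans)
    then show "axis (coord i) 1 \<bullet> (axis (coord j) 1 :: real ^ 'n) = 0" by (simp add: inner_axis_axis)
  qed simp
  moreover have "span ((\<lambda>j. axis (coord j) 1 :: real ^ 'n) ` {..<k})
      \<subseteq> span ((\<lambda>j. axis (coord j) 1) ` {..<Suc k})" for k
    by (intro span_mono) auto
  ultimately show ?thesis
    by (simp add: flags_def std_flag_def Mod_def subspace_span)
qed

text \<open>Choose in each \<open>F (Suc k)\<close> a unit vector orthogonal to \<open>F k\<close>.
  These form an orthonormal basis adapted to \<open>F\<close>, and the matrix with these columns
  carries the standard flag to \<open>F\<close>.\<close>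

lemma flag_transitive:
  fixes F :: "nat \<Rightarrow> (real ^ 'n) set"
  assumes F: "F \<in> flags"
  obtains g where "orthogonal_matrix g" "F = act g std_flag"
proof -
  have sub: "subspace (F k)" "dim (F k) = k" if "k \<le> CARD('n)" for k
    using F that by (auto simp: flags_def Mod_def)
  have mono: "F i \<subseteq> F j" if "i \<le> j" "j \<le> CARD('n)" for i j
    using that
  proof (induction j rule: dec_induct)
    case (step m)
    then have "F m \<subseteq> F (Suc m)" using F by (simp add: flags_def)
    then show ?case using step by simp
  qed simp
  have "\<exists>e. e \<in> F (Suc k) \<and> norm e = 1 \<and> (\<forall>v\<in>F k. e \<bullet> v = 0)" if "k < CARD('n)" for k
  proof -
    have "F k \<noteq> F (Suc k)" using sub[of k] sub[of "Suc k"] that by force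
    moreover have "span (F k) = F k" "span (F (Suc k)) = F (Suc k)"
      using sub[of k] sub[of "Suc k"] that by simp_all
    moreover have "F k \<subseteq> F (Suc k)" using mono[of k "Suc k"] that by simp
    ultimately have "span (F k) \<subset> span (F (Suc k))" by (metis psubsetI)
    then obtain x where x: "x \<noteq> 0" "x \<in> span (F (Suc k))" "\<And>y. y \<in> span (F k) \<Longrightarrow> orthogonal x y"
      by (rule orthogonal_to_subspace_exists_gen) blast
    have "sgn x \<in> F (Suc k)"
      using x(2) sub[of "Suc k"] that by (metis sgn_div_norm span_eq_iff span_scale Suc_leI)
    moreover have "norm (sgn x) = 1" using x(1) by (simp add: norm_sgn)
    moreover have "\<forall>v\<in>F k. sgn x \<bullet> v = 0"
      using x(3) by (auto simp: sgn_div_norm orthogonal_def span_base)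
    ultimately show ?thesis by blast
  qed
  then obtain e where e: "\<And>k. k < CARD('n) \<Longrightarrow> e k \<in> F (Suc k)"
      "\<And>k. k < CARD('n) \<Longrightarrow> norm (e k) = 1"
      "\<And>k v. k < CARD('n) \<Longrightarrow> v \<in> F k \<Longrightarrow> e k \<bullet> v = 0"
    by metis
  have o: "e i \<bullet> e j = 0" if "i < j" "j < CARD('n)" for i j
    using e(1)[of i] e(3)[of j "e i"] mono[of "Suc i" j] that by (auto simp: inner_commute)
  have orth: "e i \<bullet> e j = 0" if "i < CARD('n)" "j < CARD('n)" "i \<noteq> j" for i j
    using o that by (metis inner_commute linorder_neqE_nat)
  have span: "F k = span (e ` {..<k})" if "k \<le> CARD('n)" for k
  proof (rule subspace_dim_equal[symmetric])
    have "e ` {..<k} \<subseteq> F k"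
    proof (rule image_subsetI)
      fix j assume "j \<in> {..<k}"
      then show "e j \<in> F k" using e(1)[of j] mono[of "Suc j" k] that by auto
    qed
    then show "span (e ` {..<k}) \<subseteq> F k" using sub[OF that] span_minimal by blast
    have "dim (span (e ` {..<k})) = k" using that e(2) orth by (intro span_orthonormal) auto
    then show "dim (F k) \<le> dim (span (e ` {..<k}))" using sub[OF that] by simp
  qed (use sub[OF that] in auto)
  define g :: "real ^ 'n ^ 'n" where "g = (\<chi> i j. e (coord_index j) $ i)"
  have c: "column j g = e (coord_index j)" for j by (simp add: g_def column_def)
  have "orthogonal_matrix g"
    unfolding orthogonal_matrix_orthonormal_columns c orthogonal_def using e(2) orth by simp
  moreover have "F = act g std_flag"
  proof
    fix k
    show "F k = act g std_flag k"
    proof (cases "k \<le> CARD('n)")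
      case True
      have "g *v axis (coord j) 1 = e j" if "j < k" for j
        using that True c[of "coord j"] by (simp add: matrix_vector_mult_basis)
      then have "(*v) g ` (\<lambda>j. axis (coord j) 1) ` {..<k} = e ` {..<k}" by (auto simp: image_image)
      then show ?thesis
        using True span by (simp add: flag_act_def std_flag_def linear_span_image[symmetric])
    next
      case False
      then show ?thesis using F by (auto simp: flag_act_def flags_def PiE_def extensional_def)
    qed
  qed
  ultimately show thesis by (rule that)
qed

lemma orthogonal_transformation_matrixE:
  fixes g :: "real ^ 'n \<Rightarrow> real ^ 'n"
  assumes "orthogonal_transformation g"
  obtains G where "orthogonal_matrix G" "g = (*v) G"
proof
  show "orthogonal_matrix (matrix g)" using assms orthogonal_transformation_matrix by blast
  show "g = (*v) (matrix g)"
    using orthogonal_transformation_linear[OF assms] by (simp add: fun_eq_iff)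
qed

lemma real_bracket_fact_pos: "real_bracket_fact m > 0"
  unfolding real_bracket_fact_def real_bracket_def
  by (intro prod_pos) (auto intro!: divide_pos_pos mult_pos_pos unit_ball_vol_pos)

section \<open>Existence and uniqueness of the invariant flag measure\<close>

locale haar_orthogonal = prob_space \<mu> for \<mu> :: "(real ^ 'n ^ 'n) measure" +
  assumes sets_haar: "sets \<mu> = sets orthogonal_group_borel"
    and left_invariant: "orthogonal_matrix h \<Longrightarrow> distr \<mu> \<mu> (\<lambda>g. h ** g) = \<mu>"
begin

lemma space_haar: "space \<mu> = {g. orthogonal_matrix g}"
  using sets_eq_imp_space_eq[OF sets_haar] by (simp add: space_restrict_space)

lemma id_measurable: "(\<lambda>g. g) \<in> borel_measurable \<mu>"
  unfolding measurable_cong_sets[OF sets_haar refl] by (intro measurable_restrict_space1) simp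

lemma mult_measurable: 
  assumes "orthogonal_matrix h"
  shows "(\<lambda>g. h ** g) \<in> measurable \<mu> \<mu>"
proof -
  note [measurable] = id_measurable
  have "(\<lambda>g. h ** g) \<in> borel_measurable \<mu>" by measurable
  then show ?thesis
    unfolding measurable_cong_sets[OF refl sets_haar]
    using assms by (intro measurable_restrict_space2) (auto simp: space_haar orthogonal_matrix_mul)
qed

lemma act_measurable: "F \<in> flags \<Longrightarrow> (\<lambda>g. act g F) \<in> measurable \<mu> flag_borel"
  by (intro measurable_act id_measurable) (auto simp: space_haar)

lemma act_transpose_measurable: "F \<in> flags \<Longrightarrow> (\<lambda>g. act (transpose g) F) \<in> measurable \<mu> flag_borel"
  using id_measurable by (intro measurable_act) (auto simp: space_haar)

lemma emeasure_left_invariant: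
  assumes "orthogonal_matrix h" "{g \<in> space \<mu>. P g} \<in> sets \<mu>"
  shows "emeasure \<mu> {g \<in> space \<mu>. P (h ** g)} = emeasure \<mu> {g \<in> space \<mu>. P g}"
proof -
  note m = mult_measurable[OF assms(1)]
  have "emeasure \<mu> {g \<in> space \<mu>. P g} = emeasure (distr \<mu> \<mu> (\<lambda>g. h ** g)) {g \<in> space \<mu>. P g}"
    by (simp add: left_invariant assms)
  also have "\<dots> = emeasure \<mu> {g \<in> space \<mu>. P (h ** g)}"
    using measurable_space[OF m] by (subst emeasure_distr[OF m assms(2)]) (auto intro!: arg_cong[of _ _ "emeasure \<mu>"])
  finally show ?thesis ..
qed

text \<open>Averaging \<open>M (g A) = M A\<close> over \<open>g\<close> and exchanging the integrals determines \<open>M\<close>.\<close>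

lemma invariant_flag_measure_unique:
  assumes M: "invariant_flag_measure (M :: (nat \<Rightarrow> (real ^ 'n) set) measure)" and A: "A \<in> sets flag_borel"
  shows "emeasure M A = ennreal (real_bracket_fact CARD('n))
    * emeasure \<mu> {g \<in> space \<mu>. act (transpose g) std_flag \<in> A}"
proof -
  have sM: "sets M = sets flag_borel" "space M = flags"
    using M by (auto simp: invariant_flag_measure_def sets_flag_borel)
  have tot: "emeasure M flags = ennreal (real_bracket_fact CARD('n))"
    using M by (simp add: invariant_flag_measure_def)
  interpret M: finite_measure M by standard (simp add: sM tot)
  interpret PM: pair_sigma_finite \<mu> M ..
  have Af: "A \<subseteq> flags" using sets.sets_into_space[OF A] by simp
  let ?Q = "{w \<in> space (\<mu> \<Otimes>\<^sub>M M). act (transpose (fst w)) (snd w) \<in> A}"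
  have "(\<lambda>w. act (transpose (fst w)) (snd w)) \<in> measurable (\<mu> \<Otimes>\<^sub>M M) flag_borel"
  proof (rule measurable_act)
    note [measurable] = measurable_compose[OF measurable_fst id_measurable]
    show "(\<lambda>w. transpose (fst w)) \<in> borel_measurable (\<mu> \<Otimes>\<^sub>M M)" by measurable
    show "snd \<in> measurable (\<mu> \<Otimes>\<^sub>M M) flag_borel"
      using measurable_snd[of \<mu> M] measurable_cong_sets[OF refl sM(1)] by blast
  qed (auto simp: space_pair_measure space_haar)
  then have Q: "?Q \<in> sets (\<mu> \<Otimes>\<^sub>M M)" using A by (rule measurable_sets_mem)
  have inv: "emeasure M {F \<in> flags. act (transpose g) F \<in> A} = emeasure M A" if "g \<in> space \<mu>" for g
  proof -
    have g: "orthogonal_matrix g" using that by (simp add: space_haar)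
    have "emeasure M (act g ` A) = emeasure M A"
      using M orthogonal_transformation_matrix_vector_mult[OF g] A sM(1) unfolding invariant_flag_measure_def by blast
    then show ?thesis unfolding act_image[OF g Af] .
  qed
  have "emeasure M A = (\<integral>\<^sup>+g. emeasure M A \<partial>\<mu>)" by (simp add: emeasure_space_1)
  also have "\<dots> = (\<integral>\<^sup>+g. emeasure M (Pair g -` ?Q) \<partial>\<mu>)"
  proof (rule nn_integral_cong)
    fix g assume g: "g \<in> space \<mu>"
    then have "Pair g -` ?Q = {F \<in> flags. act (transpose g) F \<in> A}"
      by (auto simp: space_pair_measure sM)
    then show "emeasure M A = emeasure M (Pair g -` ?Q)" using inv[OF g] by simp
  qed
  also have "\<dots> = emeasure (\<mu> \<Otimes>\<^sub>M M) ?Q" by (rule M.emeasure_pair_measure_alt[OF Q, symmetric])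
  also have "\<dots> = (\<integral>\<^sup>+F. emeasure \<mu> ((\<lambda>g. (g, F)) -` ?Q) \<partial>M)"
    by (rule PM.emeasure_pair_measure_alt2[OF Q])
  also have "\<dots> = (\<integral>\<^sup>+F. emeasure \<mu> {g \<in> space \<mu>. act (transpose g) std_flag \<in> A} \<partial>M)"
  proof (rule nn_integral_cong)
    fix F assume "F \<in> space M"
    then have F: "F \<in> flags" by (simp add: sM)
    then obtain h where h: "orthogonal_matrix h" "F = act h std_flag" by (rule flag_transitive)
    \<comment> \<open>Transitivity enters here: \<open>F\<close> is a translate of
      \<open>std_flag\<close> by \<open>h\<close>, and left invariance of \<mu> absorbs
      \<open>h\<close>, so the inner integral does not depend on \<open>F\<close>.\<close>
    have "(\<lambda>g. (g, F)) -` ?Q = {g \<in> space \<mu>. act (transpose (transpose h ** g)) std_flag \<in> A}"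
      using F h(2) by (auto simp: space_pair_measure sM matrix_transpose_mul act_mult)
    also have "emeasure \<mu> \<dots> = emeasure \<mu> {g \<in> space \<mu>. act (transpose g) std_flag \<in> A}"
      using h(1) measurable_sets_mem[OF act_transpose_measurable[OF std_flag_in_flags] A]
      by (intro emeasure_left_invariant) auto
    finally show "emeasure \<mu> ((\<lambda>g. (g, F)) -` ?Q) = emeasure \<mu> {g \<in> space \<mu>. act (transpose g) std_flag \<in> A}" .
  qed
  also have "\<dots> = emeasure \<mu> {g \<in> space \<mu>. act (transpose g) std_flag \<in> A} * emeasure M flags"
    by (simp add: sM)
  finally show ?thesis by (simp add: tot mult.commute)
qed

definition orbit_measure :: "(nat \<Rightarrow> (real ^ 'n) set) \<Rightarrow> (nat \<Rightarrow> (real ^ 'n) set) measure" where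
  "orbit_measure F =
     scale_measure (ennreal (real_bracket_fact CARD('n))) (distr \<mu> flag_borel (\<lambda>g. act g F))"

lemma emeasure_orbit_measure:
  assumes "F \<in> flags" "A \<in> sets flag_borel"
  shows "emeasure (orbit_measure F) A
    = ennreal (real_bracket_fact CARD('n)) * emeasure \<mu> {g \<in> space \<mu>. act g F \<in> A}"
  using assms act_measurable[OF assms(1)]
  by (auto simp: orbit_measure_def emeasure_distr intro!: arg_cong[of _ _ "\<lambda>B. _ * emeasure \<mu> B"])

lemma invariant_orbit_measure:
  assumes F: "F \<in> flags"
  shows "invariant_flag_measure (orbit_measure F)"
  unfolding invariant_flag_measure_def
proof (intro conjI allI impI)
  show sp: "space (orbit_measure F) = flags" by (simp add: orbit_measure_def space_scale_measure)
  show "sets (orbit_measure F) = sigma_sets flags {U. openin flag_topology U}"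
    by (simp add: orbit_measure_def sets_flag_borel)
  have "{g \<in> space \<mu>. act g F \<in> flags} = space \<mu>" using F by (auto simp: space_haar act_in_flags)
  then show "emeasure (orbit_measure F) flags = ennreal (real_bracket_fact CARD('n))"
    using emeasure_orbit_measure[OF F sets.top] by (simp add: emeasure_space_1)
  fix g :: "real ^ 'n \<Rightarrow> real ^ 'n" and A
  assume g: "orthogonal_transformation g" and "A \<in> sets (orbit_measure F)"
  then have A: "A \<in> sets flag_borel" by (simp add: orbit_measure_def)
  then have Af: "A \<subseteq> flags" using sets.sets_into_space by fastforce
  obtain G where G: "orthogonal_matrix G" "g = (*v) G" using g by (rule orthogonal_transformation_matrixE)
  have "(\<lambda>F. act (transpose G) F) \<in> measurable flag_borel flag_borel"
    using G by (intro measurable_act) auto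
  from measurable_sets_mem[OF this A] have "act G ` A \<in> sets flag_borel"
    unfolding act_image[OF G(1) Af] by simp
  then have "emeasure (orbit_measure F) (act G ` A) = ennreal (real_bracket_fact CARD('n))
      * emeasure \<mu> {x \<in> space \<mu>. act x F \<in> act G ` A}"
    using F by (intro emeasure_orbit_measure)
  also have "{x \<in> space \<mu>. act x F \<in> act G ` A} = {x \<in> space \<mu>. act (transpose G ** x) F \<in> A}"
    unfolding act_image[OF G(1) Af] act_mult using F by (auto simp: space_haar act_in_flags)
  also have "emeasure \<mu> \<dots> = emeasure \<mu> {x \<in> space \<mu>. act x F \<in> A}"
    using G(1) measurable_sets_mem[OF act_measurable[OF F] A] by (intro emeasure_left_invariant) auto
  finally show "emeasure (orbit_measure F) (flag_act g ` A) = emeasure (orbit_measure F) A"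
    unfolding G(2) using emeasure_orbit_measure[OF F A] by simp
qed

text \<open>Both sides are invariant, and the averaging formula depends on \<open>A\<close> alone.
  In particular the orbit measures of any two flags agree, so each partition can later be tested
  with a flag of its own.\<close>

lemma invariant_flag_measure_eq_orbit_measure:
  assumes M: "invariant_flag_measure M" and F: "F \<in> flags"
  shows "M = orbit_measure F"
proof (rule measure_eqI)
  show s: "sets M = sets (orbit_measure F)"
    using M by (simp add: invariant_flag_measure_def orbit_measure_def sets_flag_borel)
  fix A assume "A \<in> sets M"
  then have "A \<in> sets flag_borel" unfolding s by (simp add: orbit_measure_def)
  then show "emeasure M A = emeasure (orbit_measure F) A"
    using invariant_flag_measure_unique M invariant_orbit_measure[OF F] by simp
qed

lemma flag_measure_eq_orbit_measure:
  assumes F: "F \<in> flags"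
  shows "flag_measure = completion (orbit_measure F)"
proof -
  have "(THE M. invariant_flag_measure M) = orbit_measure F"
    using invariant_orbit_measure[OF F] invariant_flag_measure_eq_orbit_measure[OF _ F]
    by (rule the_equality)
  then show ?thesis by (simp add: flag_measure_def)
qed

text \<open>A set measurable for the completion may have a nonmeasurable preimage under an orbit
  map. Its Borel main part has the same measure, and one such \<open>S\<close> works for all base
  flags \<open>F\<close> at once.\<close>

lemma flag_measure_inner:
  assumes E: "E \<in> sets flag_measure"
  obtains S where "S \<in> sets flag_borel" "S \<subseteq> E"
    "\<And>F. F \<in> flags \<Longrightarrow> measure flag_measure E
       = real_bracket_fact CARD('n) * measure \<mu> {g \<in> space \<mu>. act g F \<in> S}"
proof
  let ?M = "orbit_measure std_flag"
  note eq = flag_measure_eq_orbit_measure[OF std_flag_in_flags]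
  have E': "E \<in> sets (completion ?M)" using E unfolding eq .
  show S: "main_part ?M E \<in> sets flag_borel"
    using main_part_sets[OF E'] by (simp add: orbit_measure_def)
  show "main_part ?M E \<subseteq> E" using main_part_null_part_Un[OF E'] by blast
  fix F :: "nat \<Rightarrow> (real ^ 'n) set" assume F: "F \<in> flags"
  have "emeasure flag_measure E = emeasure ?M (main_part ?M E)"
    unfolding eq by (rule emeasure_completion[OF E'])
  also have "\<dots> = emeasure (orbit_measure F) (main_part ?M E)"
    using invariant_flag_measure_eq_orbit_measure[OF invariant_orbit_measure[OF std_flag_in_flags] F]
    by simp
  finally show "measure flag_measure E
      = real_bracket_fact CARD('n) * measure \<mu> {g \<in> space \<mu>. act g F \<in> main_part ?M E}"
    using real_bracket_fact_pos[of "CARD('n)"]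
    by (simp add: emeasure_orbit_measure[OF F S] measure_def enn2real_mult)
qed

end

section \<open>Families of decompositions\<close>

definition coord_subspace :: "'n set \<Rightarrow> (real ^ 'n) set" where
  "coord_subspace U = {v. \<forall>i. i \<notin> U \<longrightarrow> v $ i = 0}"

lemma subspace_coord_subspace: "subspace (coord_subspace U)"
  by (auto simp: subspace_def coord_subspace_def)

lemma dim_coord_subspace: "dim (coord_subspace U :: (real ^ 'n) set) = card U"
  unfolding coord_subspace_def using dim_substandard_cart[of U, where ?'a = real] by (simp add: dim_vec_eq)

lemma coord_subspace_mono: "U \<subseteq> V \<Longrightarrow> coord_subspace U \<subseteq> coord_subspace V"
  by (auto simp: coord_subspace_def)

lemma coord_subspace_inject:
  fixes U V :: "'n::finite set"
  shows "coord_subspace U = coord_subspace V \<Longrightarrow> U = V"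
proof -
  have "U = {i. axis i 1 \<in> (coord_subspace U :: (real ^ 'n) set)}" for U :: "'n set"
    by (auto simp: coord_subspace_def axis_def)
  then show "coord_subspace U = coord_subspace V \<Longrightarrow> U = V" by metis
qed

lemma coord_subspace_Un: "coord_subspace (U \<union> V) = coord_subspace U + coord_subspace V"
proof
  show "coord_subspace U + coord_subspace V \<subseteq> coord_subspace (U \<union> V)"
    by (auto simp: coord_subspace_def elim!: set_plus_elim)
  show "coord_subspace (U \<union> V) \<subseteq> coord_subspace U + coord_subspace V"
  proof
    fix v assume v: "v \<in> coord_subspace (U \<union> V)"
    let ?u = "(\<chi> i. if i \<in> U then v $ i else 0)"
    have "?u \<in> coord_subspace U" "v - ?u \<in> coord_subspace V"
      using v by (auto simp: coord_subspace_def)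
    then have "?u + (v - ?u) \<in> coord_subspace U + coord_subspace V" by (rule set_plus_intro)
    then show "v \<in> coord_subspace U + coord_subspace V" by simp
  qed
qed

lemma coord_subspace_UN:
  assumes "finite I"
  shows "coord_subspace (\<Union>i\<in>I. P i) = (\<Sum>i\<in>I. coord_subspace (P i))"
  using assms
proof (induction I rule: finite_induct)
  case empty
  show ?case by (auto simp: coord_subspace_def vec_eq_iff)
qed (simp add: coord_subspace_Un)

lemma linear_image_set_sum:
  fixes f :: "'a::real_vector \<Rightarrow> 'b::real_vector"
  assumes "linear f" "finite I"
  shows "f ` (\<Sum>i\<in>I. S i) = (\<Sum>i\<in>I. f ` S i)"
  using assms(2)
proof (induction I rule: finite_induct)
  case empty
  show ?case using linear_0[OF assms(1)] by auto
next
  case (insert i I)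
  have "f ` (A + B) = f ` A + f ` B" for A B
    using linear_add[OF assms(1)] by (force simp: set_plus_def image_iff)
  then show ?case using insert by simp
qed

lemma orthogonal_summand_eq:
  fixes A B :: "'a::real_inner set"
  assumes "\<And>a b. a \<in> A \<Longrightarrow> b \<in> B \<Longrightarrow> orthogonal a b" "0 \<in> A"
  shows "B = {y \<in> A + B. \<forall>z\<in>A. orthogonal z y}"
proof (intro set_eqI iffI)
  fix y assume "y \<in> B"
  then have "0 + y \<in> A + B" using assms(2) by (intro set_plus_intro)
  then show "y \<in> {y \<in> A + B. \<forall>z\<in>A. orthogonal z y}" using assms(1) \<open>y \<in> B\<close> by simp
next
  fix y assume y: "y \<in> {y \<in> A + B. \<forall>z\<in>A. orthogonal z y}"
  then obtain a b where ab: "y = a + b" "a \<in> A" "b \<in> B" by (auto elim: set_plus_elim)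
  then have "a \<bullet> (a + b) = 0" "a \<bullet> b = 0" using y assms(1) by (auto simp: orthogonal_def)
  then have "a = 0" by (simp add: inner_add_right)
  then show "y \<in> B" using ab by simp
qed

text \<open>Each summand is the orthogonal complement of the preceding partial sum inside the next
  one. Hence a flag, which only sees partial sums, still determines the decomposition.\<close>

lemma orthogonal_partial_sums_determine:
  fixes D E :: "nat \<Rightarrow> 'a::real_inner set"
  assumes D: "\<And>i. i \<in> {1..r} \<Longrightarrow> 0 \<in> D i"
      "\<And>i j x y. i \<in> {1..r} \<Longrightarrow> j \<in> {1..r} \<Longrightarrow> i \<noteq> j \<Longrightarrow> x \<in> D i \<Longrightarrow> y \<in> D j \<Longrightarrow> orthogonal x y"
    and E: "\<And>i. i \<in> {1..r} \<Longrightarrow> 0 \<in> E i"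
      "\<And>i j x y. i \<in> {1..r} \<Longrightarrow> j \<in> {1..r} \<Longrightarrow> i \<noteq> j \<Longrightarrow> x \<in> E i \<Longrightarrow> y \<in> E j \<Longrightarrow> orthogonal x y"
    and eq: "\<And>i. i \<in> {1..r} \<Longrightarrow> (\<Sum>j\<in>{1..i}. D j) = (\<Sum>j\<in>{1..i}. E j)"
    and i: "i \<in> {1..r}"
  shows "D i = E i"
proof -
  have *: "C i = {y \<in> (\<Sum>j\<in>{1..i}. C j). \<forall>z\<in>(\<Sum>j\<in>{1..i - 1}. C j). orthogonal z y}"
    if C: "\<And>i. i \<in> {1..r} \<Longrightarrow> 0 \<in> C i"
      "\<And>i j x y. i \<in> {1..r} \<Longrightarrow> j \<in> {1..r} \<Longrightarrow> i \<noteq> j \<Longrightarrow> x \<in> C i \<Longrightarrow> y \<in> C j \<Longrightarrow> orthogonal x y"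
    for C :: "nat \<Rightarrow> 'a set"
  proof -
    let ?A = "\<Sum>j\<in>{1..i - 1}. C j"
    have e: "{1..i} = insert i {1..i - 1}" and ni: "i \<notin> {1..i - 1}" using i by auto
    have "(\<Sum>j\<in>{1..i}. C j) = C i + ?A" unfolding e by (rule sum.insert[OF finite_atLeastAtMost ni])
    then have "(\<Sum>j\<in>{1..i}. C j) = ?A + C i" by (simp only: add.commute)
    moreover have "orthogonal a b" if "a \<in> ?A" "b \<in> C i" for a b
    proof -
      obtain s where "a = sum s {1..i - 1}" "\<forall>j\<in>{1..i - 1}. s j \<in> C j"
        using \<open>a \<in> ?A\<close> by (auto simp: set_sum_alt)
      moreover from this have "s j \<bullet> b = 0" if "j \<in> {1..i - 1}" for j
        using C(2)[of j i "s j" b] that \<open>b \<in> C i\<close> i by (auto simp: orthogonal_def)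
      ultimately show ?thesis by (simp add: orthogonal_def inner_sum_left)
    qed
    moreover have "0 \<in> ?A"
      using C(1) i by (auto simp: set_sum_alt intro!: exI[of _ "\<lambda>_. 0"])
    ultimately show ?thesis using orthogonal_summand_eq[of ?A "C i"] by simp
  qed
  \<comment> \<open>For \<open>i = 1\<close> both sums are empty; the hypothesis on partial sums
    starts at index 1 and covers the other cases.\<close>
  have "(\<Sum>j\<in>{1..i - 1}. D j) = (\<Sum>j\<in>{1..i - 1}. E j)"
  proof (cases "i = 1")
    case False
    then have "i - 1 \<in> {1..r}" using i by auto
    then show ?thesis by (rule eq)
  qed simp
  then show ?thesis using *[of D, OF D] *[of E, OF E] eq[OF i] by simp
qed

text \<open>List the coordinates block after block and take the coordinate subspaces of the
  prefixes; the list \<open>L i\<close> of the first \<open>i\<close> blocks is itself a prefix of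
  \<open>L r\<close>.\<close>

lemma flag_through_partition_exists:
  fixes P :: "nat \<Rightarrow> 'n::finite set"
  assumes P: "P \<in> ordered_partitions {1..r} UNIV"
  shows "\<exists>F\<in>flags. \<forall>i\<in>{1..r}.
    F (\<Sum>j\<in>{1..i}. card (P j)) = coord_subspace (\<Union>j\<in>{1..i}. P j)"
proof -
  have "\<forall>j. \<exists>xs. set xs = P j \<and> distinct xs" by (simp add: finite_distinct_list)
  then obtain xs where xs: "\<And>j. set (xs j) = P j" "\<And>j. distinct (xs j)" by metis
  define L where "L i = concat (map xs [1..<Suc i])" for i
  have L_Suc: "L (Suc i) = L i @ xs (Suc i)" for i by (simp add: L_def)
  have set_L: "set (L i) = (\<Union>j\<in>{1..i}. P j)" for i
  proof (induction i)
    case (Suc i)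
    then show ?case by (auto simp: L_Suc xs atLeastAtMostSuc_conv)
  qed (simp add: L_def)
  have length_L: "length (L i) = (\<Sum>j\<in>{1..i}. card (P j))" for i
  proof (induction i)
    case (Suc i)
    then show ?case using xs[of "Suc i"] by (simp add: L_Suc distinct_card[symmetric])
  qed (simp add: L_def)
  have distinct_L: "distinct (L i)" if "i \<le> r" for i
    using that
  proof (induction i)
    case (Suc i)
    have "P j \<inter> P (Suc i) = {}" if "j \<in> {1..i}" for j
      using P that Suc(2) unfolding ordered_partitions_def disjoint_family_on_def by auto
    then have "set (L i) \<inter> set (xs (Suc i)) = {}" unfolding set_L xs by blast
    then show ?case using Suc xs by (simp add: L_Suc)
  qed (simp add: L_def)
  have take_L: "take (length (L i)) (L r) = L i" if "i \<le> r" for i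
    using that
  proof (induction r rule: dec_induct)
    case (step m)
    have "length (L i) \<le> length (L m)" using step(3) by (metis nat_le_linear take_all_iff take_all)
    then show ?case using step by (simp add: L_Suc)
  qed simp
  have len: "length (L r) = CARD('n)"
  proof -
    have "set (L r) = UNIV" using P unfolding set_L ordered_partitions_def by blast
    then show ?thesis using distinct_card[OF distinct_L[OF order_refl]] by simp
  qed
  define F :: "nat \<Rightarrow> (real ^ 'n) set"
    where "F = (\<lambda>k\<in>{..CARD('n)}. coord_subspace (set (take k (L r))))"
  have "F \<in> flags"
  proof -
    have "card (set (take k (L r))) = k" if "k \<le> CARD('n)" for k
      using that len distinct_L by (simp add: distinct_card)
    moreover have "set (take k (L r)) \<subseteq> set (take (Suc k) (L r))" for k
      by (rule set_take_subset_set_take) simp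
    ultimately show ?thesis
      by (simp add: flags_def F_def Mod_def subspace_coord_subspace dim_coord_subspace coord_subspace_mono)
  qed
  moreover have "F (\<Sum>j\<in>{1..i}. card (P j)) = coord_subspace (\<Union>j\<in>{1..i}. P j)" if "i \<in> {1..r}" for i
  proof -
    have "length (L i) \<le> CARD('n)"
      using take_L[of i] that len by (metis atLeastAtMost_iff length_take min.cobounded1)
    then show ?thesis
      unfolding length_L[symmetric] set_L[symmetric] using take_L[of i] that by (simp add: F_def)
  qed
  ultimately show ?thesis by blast
qed

text \<open>The way back from flags to decompositions: \<open>D\<close> and the rotated coordinate
  decomposition are both orthogonal, and their partial sums are the same members of the
  flag.\<close>

lemma compatible_determines_decomposition:
  fixes g :: "real ^ 'n ^ 'n"
  assumes g: "orthogonal_matrix g" and P: "P \<in> ordered_partitions {1..r} UNIV"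
    and a: "\<And>i. i \<in> {1..r} \<Longrightarrow> a i = card (P i)"
    and F: "\<And>i. i \<in> {1..r} \<Longrightarrow>
       F (\<Sum>j\<in>{1..i}. card (P j)) = coord_subspace (\<Union>j\<in>{1..i}. P j)"
    and D: "D \<in> decompositions r" and c: "compatible r a (act g F) D"
    and i: "i \<in> {1..r}"
  shows "D i = (*v) g ` coord_subspace (P i)"
proof (rule orthogonal_partial_sums_determine[OF _ _ _ _ _ i])
  show "0 \<in> D i" if "i \<in> {1..r}" for i
    using D that PiE_mem[of D "{1..r}" "\<lambda>_. Mod" i] by (simp add: decompositions_def Mod_def subspace_0)
  show "orthogonal x y" if "i \<in> {1..r}" "j \<in> {1..r}" "i \<noteq> j" "x \<in> D i" "y \<in> D j" for i j x y
    using D that by (auto simp: decompositions_def)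
  show "0 \<in> (*v) g ` coord_subspace (P i)" for i
    by (rule image_eqI[of _ _ 0]) (simp_all add: coord_subspace_def)
  show "orthogonal x y" if ij: "i \<in> {1..r}" "j \<in> {1..r}" "i \<noteq> j"
    and xy: "x \<in> (*v) g ` coord_subspace (P i)" "y \<in> (*v) g ` coord_subspace (P j)" for i j x y
  proof -
    obtain u v where uv: "x = g *v u" "y = g *v v" "u \<in> coord_subspace (P i)" "v \<in> coord_subspace (P j)"
      using xy by blast
    have "P i \<inter> P j = {}"
      using P ij unfolding ordered_partitions_def disjoint_family_on_def by blast
    then have "u $ k * v $ k = 0" for k using uv(3,4) unfolding coord_subspace_def by auto
    then have "u \<bullet> v = 0" by (simp only: inner_vec_def inner_real_def sum.neutral_const)
    then show ?thesis
      using orthogonal_transformation_matrix_vector_mult[OF g] uv by (simp add: orthogonal_def orthogonal_transformation_def)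
  qed
  show "(\<Sum>j\<in>{1..i}. D j) = (\<Sum>j\<in>{1..i}. (*v) g ` coord_subspace (P j))" if i: "i \<in> {1..r}" for i
  proof -
    \<comment> \<open>Disjointness bounds the partial sum of block sizes by \<open>n\<close>; this
      is needed because \<open>flag_act\<close> is \<open>undefined\<close> at larger
      indices.\<close>
    have "disjoint_family_on P {1..i}"
      using P i unfolding ordered_partitions_def disjoint_family_on_def by auto
    then have "(\<Sum>j\<in>{1..i}. card (P j)) = card (\<Union>j\<in>{1..i}. P j)"
      by (simp add: card_UN_disjoint disjoint_family_on_def)
    also have "\<dots> \<le> CARD('n)" by (intro card_mono) auto
    finally have le: "(\<Sum>j\<in>{1..i}. card (P j)) \<le> CARD('n)" .
    have "(\<Sum>j\<in>{1..i}. a j) = (\<Sum>j\<in>{1..i}. card (P j))" using a i by (intro sum.cong) auto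
    then have "(\<Sum>j\<in>{1..i}. D j) = act g F (\<Sum>j\<in>{1..i}. card (P j))"
      using c i unfolding compatible_def by metis
    also have "\<dots> = (*v) g ` coord_subspace (\<Union>j\<in>{1..i}. P j)"
      using le F[OF i] by (simp add: flag_act_def)
    finally show ?thesis by (simp add: coord_subspace_UN linear_image_set_sum)
  qed
qed

text \<open>An injective monotone map sends chains to chains of the same size. It transports
  chain-freeness from subspaces back to subsets of the coordinates.\<close>

lemma chain_free_vimage:
  assumes B: "chain_free t B" and f: "inj_on f A" "f ` A \<subseteq> B"
    and mono: "\<And>U V. U \<in> A \<Longrightarrow> V \<in> A \<Longrightarrow> U \<subseteq> V \<Longrightarrow> f U \<subseteq> f V"
  shows "chain_free t A"
  unfolding chain_free_def
proof
  assume "\<exists>C\<subseteq>A. finite C \<and> card C = t + 1 \<and> chain\<^sub>\<subseteq> C"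
  then obtain C where C: "C \<subseteq> A" "finite C" "card C = t + 1" "chain\<^sub>\<subseteq> C" by blast
  have "card (f ` C) = t + 1" using C f by (metis card_image inj_on_subset)
  moreover have "chain\<^sub>\<subseteq> (f ` C)"
    unfolding chain_subset_def
  proof (intro ballI)
    fix X Y assume "X \<in> f ` C" "Y \<in> f ` C"
    then obtain U V where UV: "U \<in> C" "V \<in> C" "X = f U" "Y = f V" by auto
    then have "U \<subseteq> V \<or> V \<subseteq> U" using C(4) unfolding chain_subset_def by simp
    moreover have "U \<in> A" "V \<in> A" using UV C(1) by auto
    ultimately show "X \<subseteq> Y \<or> Y \<subseteq> X" using mono[of U V] mono[of V U] UV by auto
  qed
  moreover have "f ` C \<subseteq> B" using C f by blast
  ultimately show False using B C(2) unfolding chain_free_def by blast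
qed

section \<open>Averaging over coordinate partitions\<close>

lemma finite_compositions: "finite (compositions n r)"
proof (rule finite_subset)
  show "compositions n r \<subseteq> {1..r} \<rightarrow>\<^sub>E {..n}"
    by (auto simp: compositions_def PiE_def Pi_def extensional_def intro: member_le_sum)
qed (simp add: finite_PiE)

text \<open>Extensional on \<open>{1..r}\<close>, so that a type can equal a member of
  \<open>compositions\<close>.\<close>

definition partition_type :: "nat \<Rightarrow> (nat \<Rightarrow> 'a set) \<Rightarrow> nat \<Rightarrow> nat" where
  "partition_type r P = (\<lambda>i\<in>{1..r}. card (P i))"

lemma (in haar_orthogonal) sum_normalized_measure_le:
  fixes t :: "nat \<Rightarrow> nat" and \<D> :: "(nat \<Rightarrow> (real ^ 'n) set) set"
  assumes m: "m \<in> {1..r}"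
    and meas: "measurable_family r \<D>"
    and cf: "\<forall>k\<in>{1..r}. chain_free (t k) (component \<D> k)"
  shows "(\<Sum>a\<in>compositions CARD('n) r.
      measure flag_measure (Flag r a (of_type r a \<D>)) / real_bracket_fact CARD('n))
    \<le> (\<Prod>i\<in>{1..r} - {m}. real (t i))"
proof -
  let ?n = "CARD('n)" and ?OP = "ordered_partitions {1..r} (UNIV :: 'n set)"
  let ?w = "\<lambda>P. inverse_multinomial {1..r} P (UNIV :: 'n set)"
  let ?x = "\<lambda>a. measure flag_measure (Flag r a (of_type r a \<D>)) / real_bracket_fact ?n"
  have "\<forall>a\<in>compositions ?n r. \<exists>S. S \<in> sets flag_borel \<and> S \<subseteq> Flag r a (of_type r a \<D>) \<and>
      (\<forall>F\<in>flags. ?x a = measure \<mu> {g \<in> space \<mu>. act g F \<in> S})"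
  proof
    fix a assume "a \<in> compositions ?n r"
    then have "Flag r a (of_type r a \<D>) \<in> sets flag_measure" using meas by (simp add: measurable_family_def)
    then obtain S where "S \<in> sets flag_borel" "S \<subseteq> Flag r a (of_type r a \<D>)"
      "\<And>F. F \<in> flags \<Longrightarrow> measure flag_measure (Flag r a (of_type r a \<D>))
         = real_bracket_fact ?n * measure \<mu> {g \<in> space \<mu>. act g F \<in> S}"
      by (rule flag_measure_inner) blast
    then show "\<exists>S. S \<in> sets flag_borel \<and> S \<subseteq> Flag r a (of_type r a \<D>) \<and>
        (\<forall>F\<in>flags. ?x a = measure \<mu> {g \<in> space \<mu>. act g F \<in> S})"
      using real_bracket_fact_pos[of ?n] by (intro exI[of _ S]) auto
  qed
  from bchoice[OF this] obtain S where S': "\<forall>a\<in>compositions ?n r.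
      S a \<in> sets flag_borel \<and> S a \<subseteq> Flag r a (of_type r a \<D>) \<and>
      (\<forall>F\<in>flags. ?x a = measure \<mu> {g \<in> space \<mu>. act g F \<in> S a})" ..
  then have S: "\<And>a. a \<in> compositions ?n r \<Longrightarrow> S a \<in> sets flag_borel"
      "\<And>a. a \<in> compositions ?n r \<Longrightarrow> S a \<subseteq> Flag r a (of_type r a \<D>)"
      "\<And>a F. a \<in> compositions ?n r \<Longrightarrow> F \<in> flags \<Longrightarrow> ?x a = measure \<mu> {g \<in> space \<mu>. act g F \<in> S a}"
    by simp_all
  \<comment> \<open>One coordinate flag is fixed for each partition, passing through the partial
    sums of its coordinate subspaces.\<close>
  have "\<forall>P\<in>?OP. \<exists>F. F \<in> flags \<and> (\<forall>i\<in>{1..r}.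
      F (\<Sum>j\<in>{1..i}. card (P j)) = coord_subspace (\<Union>j\<in>{1..i}. P j))"
    using flag_through_partition_exists by (intro ballI) (simp add: Bex_def)
  from bchoice[OF this] obtain F where F': "\<forall>P\<in>?OP. F P \<in> flags \<and> (\<forall>i\<in>{1..r}.
      F P (\<Sum>j\<in>{1..i}. card (P j)) = coord_subspace (\<Union>j\<in>{1..i}. P j))" ..
  then have F: "\<And>P. P \<in> ?OP \<Longrightarrow> F P \<in> flags"
      "\<And>P i. P \<in> ?OP \<Longrightarrow> i \<in> {1..r} \<Longrightarrow>
         F P (\<Sum>j\<in>{1..i}. card (P j)) = coord_subspace (\<Union>j\<in>{1..i}. P j)"
    by simp_all
  \<comment> \<open>These are the partitions without empty blocks, since the entries of a
    composition are positive.\<close>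
  define \<P> where "\<P> = {P \<in> ?OP. partition_type r P \<in> compositions ?n r}"
  have fin: "finite \<P>" unfolding \<P>_def using finite_ordered_partitions[of "{1..r}" "UNIV :: 'n set"] by simp
  have type_sum: "(\<Sum>P\<in>{P \<in> \<P>. partition_type r P = a}. ?w P) = 1" if a: "a \<in> compositions ?n r" for a
  proof -
    have "{P \<in> \<P>. partition_type r P = a} = {P \<in> ?OP. \<forall>i\<in>{1..r}. card (P i) = a i}"
      using a by (auto simp: \<P>_def partition_type_def fun_eq_iff compositions_def PiE_def extensional_def)
    then show ?thesis using sum_inverse_multinomial_type[of "{1..r}" "UNIV :: 'n set" a] a by (simp add: compositions_def)
  qed
  define B where "B P = {g \<in> space \<mu>. act g (F P) \<in> S (partition_type r P)}" for P
  have B_sets: "B P \<in> sets \<mu>" if "P \<in> \<P>" for P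
    unfolding B_def using that S(1) F(1)
    by (intro measurable_sets_mem[OF act_measurable]) (auto simp: \<P>_def)
  \<comment> \<open>Every event \<open>B P\<close> of type \<open>a\<close> has the same probability
    \<open>?x a\<close>, and the weights of that type sum to 1, so \<open>?x a\<close> is their
    weighted average.\<close>
  have "(\<Sum>a\<in>compositions ?n r. ?x a)
      = (\<Sum>a\<in>compositions ?n r. \<Sum>P\<in>{P \<in> \<P>. partition_type r P = a}. ?w P * measure \<mu> (B P))"
  proof (rule sum.cong[OF refl])
    fix a assume a: "a \<in> compositions ?n r"
    have "(\<Sum>P\<in>{P \<in> \<P>. partition_type r P = a}. ?w P * measure \<mu> (B P))
        = (\<Sum>P\<in>{P \<in> \<P>. partition_type r P = a}. ?w P * ?x a)"
    proof (rule sum.cong[OF refl])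
      fix P assume "P \<in> {P \<in> \<P>. partition_type r P = a}"
      then show "?w P * measure \<mu> (B P) = ?w P * ?x a"
        using S(3)[OF a, of "F P"] F(1)[of P] by (simp add: B_def \<P>_def)
    qed
    also have "\<dots> = ?x a" unfolding sum_distrib_right[symmetric] type_sum[OF a] by simp
    finally show "?x a = (\<Sum>P\<in>{P \<in> \<P>. partition_type r P = a}. ?w P * measure \<mu> (B P))" ..
  qed
  also have "\<dots> = (\<Sum>P\<in>\<P>. ?w P * measure \<mu> (B P))"
    by (rule sum.group[OF fin finite_compositions]) (auto simp: \<P>_def)
  \<comment> \<open>From here on the bound is proved pointwise, for each orthogonal matrix
    \<open>g\<close>.\<close>
  also have "\<dots> = (\<integral>g. (\<Sum>P\<in>\<P>. ?w P * indicator (B P) g) \<partial>\<mu>)"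
    using B_sets by (subst Bochner_Integration.integral_sum) (auto simp: emeasure_eq_measure)
  also have "\<dots> \<le> (\<Prod>i\<in>{1..r} - {m}. real (t i))"
  proof (rule integral_le_const)
    show "integrable \<mu> (\<lambda>g. \<Sum>P\<in>\<P>. ?w P * indicator (B P) g)"
      using B_sets by (intro Bochner_Integration.integrable_sum integrable_mult_right) (auto simp: emeasure_eq_measure)
    show "AE g in \<mu>. (\<Sum>P\<in>\<P>. ?w P * indicator (B P) g) \<le> (\<Prod>i\<in>{1..r} - {m}. real (t i))"
    proof (rule AE_I2)
      fix g assume "g \<in> space \<mu>"
      then have g: "orthogonal_matrix g" by (simp add: space_haar)
      \<comment> \<open>For a partition in \<open>\<M>\<close> the flag \<open>act g (F P)\<close>
        lies in the chosen Borel set, hence is compatible with a member of \<D>, which must be the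
        rotated coordinate decomposition. So rotating coordinate subspaces embeds the
        \<open>i\<close>-th blocks into \<open>component \<D> i\<close>.\<close>
      define \<M> where "\<M> = {P \<in> \<P>. g \<in> B P}"
      have im: "(\<lambda>P. (*v) g ` coord_subspace (P i)) ` \<M> \<subseteq> component \<D> i" if i: "i \<in> {1..r}" for i
      proof (rule image_subsetI)
        fix P assume "P \<in> \<M>"
        then have P: "P \<in> ?OP" "partition_type r P \<in> compositions ?n r"
          "act g (F P) \<in> S (partition_type r P)"
          by (auto simp: \<M>_def \<P>_def B_def)
        then have "act g (F P) \<in> Flag r (partition_type r P) (of_type r (partition_type r P) \<D>)"
          using S(2) by blast
        then obtain D where D: "D \<in> \<D>" "D \<in> decompositions r"
          "compatible r (partition_type r P) (act g (F P)) D"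
          by (auto simp: Flag_def of_type_def)
        have "D i = (*v) g ` coord_subspace (P i)"
          using F(2)[OF P(1)]
          by (intro compatible_determines_decomposition[OF g P(1) _ _ D(2,3) i])
             (auto simp: partition_type_def)
        then show "(*v) g ` coord_subspace (P i) \<in> component \<D> i"
          using D(1) by (auto simp: component_def)
      qed
      have ins: "insert m ({1..r} - {m}) = {1..r}" using m by blast
      have "(\<Sum>P\<in>\<P>. ?w P * indicator (B P) g) = (\<Sum>P\<in>\<M>. ?w P)"
        unfolding \<M>_def by (subst sum.inter_filter[OF fin]) (auto intro!: sum.cong simp: indicator_def)
      also have "\<dots> \<le> (\<Prod>i\<in>{1..r} - {m}. real (t i))"
      proof (rule meshalkin_chain_free[of "{1..r} - {m}" m UNIV \<M> t, unfolded ins])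
        show "\<M> \<subseteq> ?OP" by (auto simp: \<M>_def \<P>_def)
        fix i assume i: "i \<in> {1..r} - {m}"
        have inj: "inj ((*v) g)"
          using orthogonal_transformation_matrix_vector_mult[OF g] by (rule orthogonal_transformation_inj)
        show "chain_free (t i) ((\<lambda>P. P i) ` \<M>)"
        proof (rule chain_free_vimage)
          show "chain_free (t i) (component \<D> i)" using cf i by blast
          show "inj_on (\<lambda>U. (*v) g ` coord_subspace U) ((\<lambda>P. P i) ` \<M>)"
            by (rule inj_onI) (simp add: inj_image_eq_iff[OF inj] coord_subspace_inject)
          show "(\<lambda>U. (*v) g ` coord_subspace U) ` (\<lambda>P. P i) ` \<M> \<subseteq> component \<D> i"
            using im[of i] i unfolding image_image by blast
        qed (intro image_mono coord_subspace_mono)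
      qed auto
      finally show "(\<Sum>P\<in>\<P>. ?w P * indicator (B P) g) \<le> (\<Prod>i\<in>{1..r} - {m}. real (t i))" .
    qed
  qed
  finally show ?thesis .
qed

theorem theorem5p1:
  fixes r :: nat
    and t :: "nat \<Rightarrow> nat"
    and \<sigma> :: nat
    and \<D> :: "(nat \<Rightarrow> (real ^ 'n) set) set"
  assumes "r > 0"
    and "\<forall>k\<in>{1..r}. t k > 0"
    and "\<sigma> = (\<Prod>k\<in>{1..r}. t k) div Max (t ` {1..r})"
    and "\<D> \<subseteq> decompositions r"
    and "measurable_family r \<D>"
    and "\<forall>k\<in>{1..r}. chain_free (t k) (component \<D> k)"
  shows "(\<Sum>a\<in>compositions CARD('n) r.
            nu r a (of_type r a \<D>) / multiflag_coeff CARD('n) r a) \<le> real \<sigma>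
         \<and> nu_total r \<D> \<le> sum_largest \<sigma> (multiflag_coeffs CARD('n) r)"
proof -
  let ?n = "CARD('n)"
  let ?x = "\<lambda>a. measure flag_measure (Flag r a (of_type r a \<D>)) / real_bracket_fact ?n"
  obtain \<mu> :: "(real ^ 'n ^ 'n) measure" where \<mu>: "prob_space \<mu>" "sets \<mu> = sets orthogonal_group_borel"
      "\<And>h. orthogonal_matrix h \<Longrightarrow> distr \<mu> \<mu> (\<lambda>g. h ** g) = \<mu>"
    using haar_exists by blast
  interpret haar_orthogonal \<mu>
    using \<mu> by (simp add: haar_orthogonal_def haar_orthogonal_axioms_def)
  \<comment> \<open>The block \<open>m\<close> to be spared is one where the maximum is attained;
    dividing by the maximum then removes exactly its factor.\<close>
  have "Max (t ` {1..r}) \<in> t ` {1..r}" using assms(1) by (intro Max_in) auto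
  then obtain m where m: "m \<in> {1..r}" "Max (t ` {1..r}) = t m" by auto
  have \<sigma>: "real \<sigma> = (\<Prod>i\<in>{1..r} - {m}. real (t i))"
  proof -
    have "(\<Prod>k\<in>{1..r}. t k) = t m * (\<Prod>k\<in>{1..r} - {m}. t k)"
      using m(1) by (intro prod.remove) auto
    then show ?thesis using m assms(2,3) by simp
  qed
  \<comment> \<open>The factorials of the parts cancel, leaving the share of all flags that are
    compatible with the family.\<close>
  have nu_eq: "nu r a (of_type r a \<D>) = ?x a * multiflag_coeff ?n r a" for a
    using real_bracket_fact_pos[of ?n] by (simp add: nu_def multiflag_coeff_def)
  have coeff_pos: "multiflag_coeff ?n r a > 0" for a
    unfolding multiflag_coeff_def by (intro divide_pos_pos prod_pos ballI real_bracket_fact_pos)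
  \<comment> \<open>Each normalised value is a probability under \<mu>; the upper bound 1 is the cap
    that the comparison with the largest coefficients relies on.\<close>
  have x: "0 \<le> ?x a \<and> ?x a \<le> 1" if "a \<in> compositions ?n r" for a
  proof -
    have "Flag r a (of_type r a \<D>) \<in> sets flag_measure"
      using assms(5) that by (simp add: measurable_family_def)
    then obtain S where "\<And>F. F \<in> flags \<Longrightarrow> measure flag_measure (Flag r a (of_type r a \<D>))
         = real_bracket_fact ?n * measure \<mu> {g \<in> space \<mu>. act g F \<in> S}"
      by (rule flag_measure_inner) blast
    from this[OF std_flag_in_flags] show ?thesis using real_bracket_fact_pos[of ?n] by simp
  qed
  have le: "(\<Sum>a\<in>compositions ?n r. ?x a) \<le> real \<sigma>"
    unfolding \<sigma> using m(1) assms(5,6) by (rule sum_normalized_measure_le)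
  have "(\<Sum>a\<in>compositions ?n r. nu r a (of_type r a \<D>) / multiflag_coeff ?n r a)
      = (\<Sum>a\<in>compositions ?n r. ?x a)"
    unfolding nu_eq using coeff_pos by (intro sum.cong) (auto simp: less_imp_neq[symmetric])
  moreover have "nu_total r \<D> \<le> sum_largest \<sigma> (multiflag_coeffs ?n r)"
    unfolding nu_total_def nu_eq multiflag_coeffs_def
    using finite_compositions x coeff_pos le by (intro sum_le_sum_largest) (auto simp: less_imp_le)
  ultimately show ?thesis using le by simp
qed

end
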